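(* Let $A,X$ be Hermitian $n\times n$ complex matrices and let $U=e^{iX}$, a unitary $n\times n$ matrix. Then $$s(A-U^*AU)\prec_w s(X)\,\mathrm{Spr}^+(A\oplus A)\quad\text{and}\quad s(A-U^*AU)\prec_w s(A)\,\mathrm{Spr}^+(X\oplus X),$$ where the products of vectors in $\mathbb{R}^n$ are taken entrywise.
   Context: For a Hermitian $m\times m$ complex matrix $A$, $\lambda(A)=(\lambda_1(A),\dots,\lambda_m(A))$ denotes its eigenvalues, counted with multiplicity, in non-increasing order. The spectral spread of $A$ is $\mathrm{Spr}^+(A)=(\lambda_i(A)-\lambda_{m-i+1}(A))_{1\le i\le [m/2]}\in\mathbb{R}_{\ge 0}^{[m/2]}$, where $[\cdot]$ is the integer part. $A\oplus A$ is the $2n\times 2n$ block diagonal matrix with both diagonal blocks equal to $A$; thus $\mathrm{Spr}^+(A\oplus A)\in\mathbb{R}^n_{\ge0}$ (a vector in non-increasing order). For an $n\times n$ complex matrix $C$, $s(C)=\lambda((C^*C)^{1/2})\in\mathbb{R}_{\ge0}^n$ is the vector of singular values in non-increasing order. Submajorization: for $x,y\in\mathbb{R}^n$, $x\prec_w y$ means $\sum_{i=1}^j x_i^{\downarrow}\le\sum_{i=1}^j y_i^{\downarrow}$ for all $1\le j\le n$, where $x^{\downarrow}$ is the non-increasing rearrangement of $x$. *)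

theory Defs
  imports
    Complex_Main
    "HOL-Library.Multiset"
    "HOL-Computational_Algebra.Fundamental_Theorem_Algebra"
    "Jordan_Normal_Form.Schur_Decomposition"
begin

definition hermitian_mat :: "complex mat \<Rightarrow> bool" where
  "hermitian_mat A \<longleftrightarrow> mat_adjoint A = A"

(* \<open>proots\<close> carries algebraic multiplicities.  Taking real parts loses nothing for a
   Hermitian matrix; for other matrices the value is not meaningful. *)
definition eigenvalues_desc :: "complex mat \<Rightarrow> real list" where
  "eigenvalues_desc A =
     rev (sorted_list_of_multiset (image_mset Re (proots (char_poly A))))"

(* With 0-based indices, lambda_(m-i+1) for 1 <= i <= [m/2] becomes position m - 1 - i
   for 0 <= i < m div 2. *)
definition spectral_spread :: "complex mat \<Rightarrow> real list" where
  "spectral_spread A =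
     (let m = dim_row A; l = eigenvalues_desc A
      in map (\<lambda>i. l ! i - l ! (m - 1 - i)) [0..<m div 2])"

definition direct_sum_mat :: "complex mat \<Rightarrow> complex mat \<Rightarrow> complex mat" where
  "direct_sum_mat A B =
     four_block_mat A (0\<^sub>m (dim_row A) (dim_col B)) (0\<^sub>m (dim_row B) (dim_col A)) B"

definition psd_mat :: "complex mat \<Rightarrow> bool" where
  "psd_mat B \<longleftrightarrow>
     hermitian_mat B \<and> (\<forall>v \<in> carrier_vec (dim_row B). 0 \<le> Re ((B *\<^sub>v v) \<bullet>c v))"

(* Every positive semidefinite matrix has exactly one positive semidefinite square root;
   other arguments are irrelevant here. *)
definition psd_sqrt :: "complex mat \<Rightarrow> complex mat" where
  "psd_sqrt A = (THE B. B \<in> carrier_mat (dim_row A) (dim_row A) \<and> psd_mat B \<and> B * B = A)"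

definition singular_values :: "complex mat \<Rightarrow> real list" where
  "singular_values C = eigenvalues_desc (psd_sqrt (mat_adjoint C * C))"

(* The exponential series is summed entrywise; it converges for every square matrix. *)
definition mat_exp :: "complex mat \<Rightarrow> complex mat" where
  "mat_exp M =
     mat (dim_row M) (dim_row M) (\<lambda>(i, j). \<Sum>k. (M ^\<^sub>m k) $$ (i, j) / fact k)"

definition submajorized :: "real list \<Rightarrow> real list \<Rightarrow> bool" (infix "\<prec>\<^sub>w" 50) where
  "x \<prec>\<^sub>w y \<longleftrightarrow>
     length x = length y \<and>
     (\<forall>j\<in>{1..length x}. sum_list (take j (rev (sort x))) \<le> sum_list (take j (rev (sort y))))"

(* \<open>map2\<close> truncates to the shorter list, so this is meaningful for equal lengths only. *)
definition entrywise_prod :: "real list \<Rightarrow> real list \<Rightarrow> real list" where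
  "entrywise_prod x y = map2 (*) x y"

end

theory Submission
  imports Defs
begin

text \<open>
  Move \<open>A\<close> along the one-parameter group generated by \<open>X\<close>: with \<open>U(t) = exp(itX)\<close>, the
  derivative of \<open>U(t)\<^sup>* A U(t)\<close> is \<open>U(t)\<^sup>* i[A,X] U(t)\<close>.  If \<open>C = A - U\<^sup>*AU\<close> and \<open>S\<close> is the sum
  of the \<open>k\<close> rank-one spectral projections of \<open>C\<close> that carry its largest eigenvalues in modulus, each
  with the sign of its eigenvalue, then the sum of the \<open>k\<close> largest singular values of \<open>C\<close> is
  \<open>tr(CS)\<close>, and the mean value theorem turns it into \<open>- tr(i[A,X] S')\<close> for some unitary
  conjugate \<open>S'\<close> of \<open>S\<close> (lemma \<open>singular_value_sum_le_commutator_form\<close>).  Everything therefore rests on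
  a bound for \<open>tr(i[A,X] S)\<close> when \<open>S\<close> is Hermitian with at most \<open>k\<close> nonzero eigenvalues, all in
  \<open>[-1,1]\<close>.

  Written in eigenbases of the three matrices, \<open>tr(i[A,X] S)\<close> is trilinear in the three lists
  of eigenvalues.  It is invariant under cyclic permutation of the matrices, changes sign under
  exchange of two of them, and does not change when a scalar is added to one of them.  Evaluating
  the trace in an eigenbasis of \<open>S\<close> gives
  \<open>|tr(i[A,X] S)| \<le> 2 \<parallel>A\<parallel> \<parallel>X\<parallel> \<parallel>S\<parallel>\<^sub>1\<close> (lemma \<open>commutator_form_bound\<close>).  Let now \<open>A\<close> be a projection \<open>E\<close>
  of rank \<open>p\<close> and \<open>X\<close> a Hermitian partial isometry \<open>T\<close> of rank \<open>q\<close>.  Replacing \<open>E\<close> by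
  \<open>E - 1/2\<close>, whose norm is \<open>1/2\<close>, gives the bound \<open>k\<close>; by cyclicity the same argument in an
  eigenbasis of \<open>T\<close> gives \<open>q\<close>; eigenbases of \<open>E\<close> and of \<open>1 - E\<close> give \<open>2p\<close> and \<open>2(n-p)\<close>
  (lemma \<open>commutator_form_extremal_bound\<close>).

  The minimum of \<open>k, q, 2p, 2(n-p)\<close> is exactly the sum of the first \<open>k\<close> entries of
  \<open>s(T) Spr\<^sup>+(E \<oplus> E)\<close>.  A general \<open>A\<close> is, up to a scalar, a nonnegative combination of its
  spectral projections onto leading eigenvectors, and \<open>X\<close> is a nonnegative combination of partial
  isometries on its leading eigenvectors in modulus.  The trace and the majorizing sum are
  additive over these layers, because \<open>s\<close> and \<open>Spr\<^sup>+\<close> are linear in a sorted list of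
  eigenvalues, so the extremal case implies the general one (lemma \<open>commutator_form_spread_bound\<close>).

  The form only changes sign when \<open>A\<close> and \<open>X\<close> are exchanged, so both claims follow from the
  same estimate; they differ in which of the two eigenvalue lists is sorted by value and which
  one by modulus.
\<close>

section \<open>Unitary matrices and unitary diagonalisation\<close>

lemma mat_mult_index:
  assumes "A \<in> carrier_mat n m" "B \<in> carrier_mat m k" "i < n" "j < k"
  shows "(A * B) $$ (i,j) = (\<Sum>l<m. A $$ (i,l) * B $$ (l,j))"
  using assms by (auto simp: scalar_prod_def lessThan_atLeast0)

lemma mat_adjoint_carrier [simp]:
  "A \<in> carrier_mat n m \<Longrightarrow> mat_adjoint A \<in> carrier_mat m n"
  unfolding mat_adjoint_def by auto

lemma mat_adjoint_dim [simp]: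
  "dim_row (mat_adjoint A) = dim_col A" "dim_col (mat_adjoint A) = dim_row A"
  unfolding mat_adjoint_def by auto

lemma square_mult_carrier [simp]:
  "A \<in> carrier_mat n n \<Longrightarrow> B \<in> carrier_mat n n \<Longrightarrow> A * B \<in> carrier_mat n n"
  by simp

lemma mat_adjoint_index:
  fixes A :: "complex mat"
  assumes "A \<in> carrier_mat n m" "i < m" "j < n"
  shows "mat_adjoint A $$ (i,j) = cnj (A $$ (j,i))"
  using assms unfolding mat_adjoint_def by (auto simp: mat_of_rows_def)

lemma mat_adjoint_adjoint:
  fixes A :: "complex mat"
  assumes "A \<in> carrier_mat n m"
  shows "mat_adjoint (mat_adjoint A) = A"
proof (rule eq_matI)
  fix i j assume "i < dim_row A" "j < dim_col A"
  thus "mat_adjoint (mat_adjoint A) $$ (i,j) = A $$ (i,j)"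
    using assms by (auto simp: mat_adjoint_index[of _ m n] mat_adjoint_index[of _ n m])
qed simp_all

lemma mat_adjoint_mult:
  fixes A B :: "complex mat"
  assumes A: "A \<in> carrier_mat n m" and B: "B \<in> carrier_mat m k"
  shows "mat_adjoint (A * B) = mat_adjoint B * mat_adjoint A" (is "?L = ?R")
proof (rule eq_matI)
  have L: "?L \<in> carrier_mat k n" and R: "?R \<in> carrier_mat k n"
    using A B by (intro mat_adjoint_carrier mult_carrier_mat; simp)+
  show "dim_row ?L = dim_row ?R" "dim_col ?L = dim_col ?R" using L R by auto
  fix i j assume "i < dim_row ?R" "j < dim_col ?R"
  hence ij: "i < k" "j < n" using R by auto
  have "?L $$ (i,j) = cnj ((A * B) $$ (j,i))"
    using A B ij by (intro mat_adjoint_index[of _ n k]) auto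
  also have "\<dots> = (\<Sum>l<m. cnj (A $$ (j,l)) * cnj (B $$ (l,i)))"
    by (simp only: mat_mult_index[OF A B ij(2,1)] cnj_sum complex_cnj_mult)
  also have "\<dots> = ?R $$ (i,j)"
    by (simp add: mat_mult_index[OF mat_adjoint_carrier[OF B] mat_adjoint_carrier[OF A] ij]
        mat_adjoint_index[OF A _ ij(2)] mat_adjoint_index[OF B ij(1)] mult.commute)
  finally show "?L $$ (i,j) = ?R $$ (i,j)" .
qed

lemma mat_adjoint_diag: "mat_adjoint (mat_diag n d) = mat_diag n (\<lambda>i. cnj (d i))"
proof (rule eq_matI)
  fix i j assume "i < dim_row (mat_diag n (\<lambda>i. cnj (d i)))" "j < dim_col (mat_diag n (\<lambda>i. cnj (d i)))"
  hence "i < n" "j < n" by (auto simp: mat_diag_def)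
  thus "mat_adjoint (mat_diag n d) $$ (i,j) = mat_diag n (\<lambda>i. cnj (d i)) $$ (i,j)"
    by (simp add: mat_adjoint_index[OF mat_diag_dim]) (simp add: mat_diag_def)
qed (simp_all add: mat_diag_def)

definition unitary :: "nat \<Rightarrow> complex mat \<Rightarrow> bool" where
  "unitary n V \<longleftrightarrow> V \<in> carrier_mat n n \<and> mat_adjoint V * V = 1\<^sub>m n"

lemma unitary_carrier: "unitary n V \<Longrightarrow> V \<in> carrier_mat n n"
  by (simp add: unitary_def)

lemma unitary_adjoint_carrier: "unitary n V \<Longrightarrow> mat_adjoint V \<in> carrier_mat n n"
  by (simp add: unitary_def)

lemma unitary_left: "unitary n V \<Longrightarrow> mat_adjoint V * V = 1\<^sub>m n"
  by (simp add: unitary_def)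

lemma unitary_right: "unitary n V \<Longrightarrow> V * mat_adjoint V = 1\<^sub>m n"
  by (rule mat_mult_left_right_inverse) (auto simp: unitary_def)

lemmas mat_assoc = assoc_mult_mat[of _ n n _ n _ n for n]

lemma unitary_cancel:
  assumes "unitary n V" "M \<in> carrier_mat n n"
  shows "mat_adjoint V * (V * M) = M" "V * (mat_adjoint V * M) = M"
  using assms unitary_left[of n V] unitary_right[of n V]
    unitary_carrier[of n V] unitary_adjoint_carrier[of n V]
  by (metis mat_assoc left_mult_one_mat)+

lemma unitary_mult:
  assumes "unitary n V" "unitary n W"
  shows "unitary n (V * W)"
  using assms unitary_carrier[of n V] unitary_adjoint_carrier[of n V]
    unitary_carrier[of n W] unitary_adjoint_carrier[of n W]
  by (auto simp: unitary_def mat_adjoint_mult[of V n n W n] mat_assoc[of _ n] unitary_cancel)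

lemma unitary_adjoint: "unitary n V \<Longrightarrow> unitary n (mat_adjoint V)"
  by (auto simp: unitary_def mat_adjoint_adjoint unitary_right)

text \<open>
  For unitary \<open>V\<close>, the matrix with eigenbasis the columns of \<open>V\<close> and eigenvalues \<open>d\<close>.
  Products, adjoints and power series then act entrywise on \<open>d\<close>.
\<close>
definition unitary_diag :: "nat \<Rightarrow> complex mat \<Rightarrow> (nat \<Rightarrow> complex) \<Rightarrow> complex mat" where
  "unitary_diag n V d = V * mat_diag n d * mat_adjoint V"

lemma unitary_diag_carrier: "unitary n V \<Longrightarrow> unitary_diag n V d \<in> carrier_mat n n"
  using unitary_carrier[of n V] unitary_adjoint_carrier[of n V] by (auto simp: unitary_diag_def)

lemma unitary_diag_index:
  assumes "unitary n V" "i < n" "j < n"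
  shows "unitary_diag n V d $$ (i,j) = (\<Sum>l<n. V $$ (i,l) * d l * cnj (V $$ (j,l)))"
proof -
  note V = unitary_carrier[OF assms(1)]
  have 1: "V * mat_diag n d \<in> carrier_mat n n" using V by auto
  show ?thesis unfolding unitary_diag_def
    using assms(2,3) V
    by (subst mat_mult_index[OF 1 mat_adjoint_carrier[OF V]])
       (auto simp: mat_diag_mult_right[OF V] mat_adjoint_index[OF V])
qed

lemma unitary_diag_cong: "(\<And>i. i < n \<Longrightarrow> d i = e i) \<Longrightarrow> unitary_diag n V d = unitary_diag n V e"
proof -
  assume "\<And>i. i < n \<Longrightarrow> d i = e i"
  hence "mat_diag n d = mat_diag n e" unfolding mat_diag_def by (intro eq_matI) auto
  thus ?thesis by (simp add: unitary_diag_def)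
qed

lemma unitary_diag_mult:
  assumes V: "unitary n V"
  shows "unitary_diag n V d * unitary_diag n V e = unitary_diag n V (\<lambda>i. d i * e i)"
proof -
  note c = unitary_carrier[OF V] unitary_adjoint_carrier[OF V]
  have "unitary_diag n V d * unitary_diag n V e
      = V * (mat_diag n d * (mat_adjoint V * (V * (mat_diag n e * mat_adjoint V))))"
    using c by (simp add: unitary_diag_def mat_assoc[of _ n])
  also have "\<dots> = V * (mat_diag n d * (mat_diag n e * mat_adjoint V))"
    using c by (simp add: unitary_cancel[OF V])
  also have "\<dots> = V * ((mat_diag n d * mat_diag n e) * mat_adjoint V)"
    using c by (simp only: mat_assoc[of _ n] mat_diag_dim)
  also have "\<dots> = unitary_diag n V (\<lambda>i. d i * e i)"
    unfolding unitary_diag_def mat_diag_diag using c by (simp add: mat_assoc[of _ n])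
  finally show ?thesis .
qed

lemma unitary_diag_one: "unitary n V \<Longrightarrow> unitary_diag n V (\<lambda>_. 1) = 1\<^sub>m n"
  using unitary_carrier[of n V] by (auto simp: unitary_diag_def unitary_right)

lemma unitary_diag_adjoint:
  assumes V: "unitary n V"
  shows "mat_adjoint (unitary_diag n V d) = unitary_diag n V (\<lambda>i. cnj (d i))"
proof -
  note c = unitary_carrier[OF V] unitary_adjoint_carrier[OF V]
  have "mat_adjoint (unitary_diag n V d) = mat_adjoint (mat_adjoint V) * mat_adjoint (V * mat_diag n d)"
    unfolding unitary_diag_def using c by (intro mat_adjoint_mult[of _ n n _ n]) auto
  also have "\<dots> = V * (mat_adjoint (mat_diag n d) * mat_adjoint V)"
    using c by (simp add: mat_adjoint_adjoint[of _ n n] mat_adjoint_mult[of V n n _ n])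
  finally show ?thesis
    using c by (simp add: unitary_diag_def mat_adjoint_diag mat_assoc[of _ n])
qed

lemma unitary_diag_diagonalize:
  assumes V: "unitary n V"
  shows "mat_adjoint V * unitary_diag n V d * V = mat_diag n d"
proof -
  note c = unitary_carrier[OF V] unitary_adjoint_carrier[OF V]
  have "mat_adjoint V * unitary_diag n V d * V = mat_adjoint V * (V * (mat_diag n d * (mat_adjoint V * V)))"
    unfolding unitary_diag_def using c by (simp add: mat_assoc[of _ n])
  thus ?thesis using c
    by (simp add: unitary_cancel[OF V] unitary_left[OF V] right_mult_one_mat[OF mat_diag_dim])
qed

lemma unitary_diag_unitary:
  assumes V: "unitary n V" and d: "\<And>i. i < n \<Longrightarrow> cmod (d i) = 1"
  shows "unitary n (unitary_diag n V d)"
proof -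
  have "unitary_diag n V (\<lambda>i. cnj (d i) * d i) = unitary_diag n V (\<lambda>_. 1)"
  proof (rule unitary_diag_cong)
    fix i assume "i < n"
    thus "cnj (d i) * d i = 1"
      using d[of i] complex_norm_square[of "d i"] by (simp add: mult.commute)
  qed
  thus ?thesis unfolding unitary_def
    using V by (simp add: unitary_diag_carrier unitary_diag_adjoint unitary_diag_mult unitary_diag_one)
qed

section \<open>The spectral theorem for Hermitian matrices\<close>

text \<open>
  Gram--Schmidt completes \<open>v\<close> to an orthogonal basis; dividing its vectors by their norms
  keeps the direction of the first one.  This is the deflation step of the spectral theorem.
\<close>
lemma unitary_first_column:
  assumes v: "v \<in> carrier_vec n" "v \<noteq> 0\<^sub>v n"
  obtains W c where "unitary n W" "col W 0 = c \<cdot>\<^sub>v v"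
proof -
  interpret cof_vec_space n "TYPE(complex)" .
  note bc = basis_completion[OF v]
  have n: "n \<noteq> 0" using v by auto
  define ws where "ws = gram_schmidt n (basis_completion v)"
  note gs = gram_schmidt_result[OF bc(2,4,5) ws_def]
  have len: "length ws = n" using gs(4) bc(6) by simp
  have "basis_completion v \<noteq> []" using bc(6) n by auto
  then obtain vs where vs: "basis_completion v = v # vs" using bc(7) by (metis list.collapse)
  have "hd ws = v" unfolding ws_def vs by (rule gram_schmidt_hd[OF v(1)])
  hence ws0: "ws ! 0 = v" using len n by (metis hd_conv_nth list.size(3))
  have wsc: "ws ! i \<in> carrier_vec n" if "i < n" for i using gs(3) len that by auto
  define r where "r i = (\<Sum>l<n. (cmod ((ws ! i) $ l))\<^sup>2)" for i
  have ip: "(\<Sum>l<n. (ws ! j) $ l * cnj ((ws ! i) $ l)) = (if i = j then complex_of_real (r i) else 0)"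
    if "i < n" "j < n" for i j
  proof -
    have "(ws ! j) \<bullet>c (ws ! i) = (\<Sum>l<n. (ws ! j) $ l * cnj ((ws ! i) $ l))"
      using wsc[OF that(1)] wsc[OF that(2)] by (auto simp: scalar_prod_def lessThan_atLeast0)
    thus ?thesis
      using corthogonalD[OF gs(2), of j i] that len
      by (auto simp: r_def complex_norm_square simp del: of_real_power)
  qed
  have r0: "r i > 0" if "i < n" for i
  proof -
    have "(ws ! i) \<bullet>c (ws ! i) \<noteq> 0" using corthogonalD[OF gs(2), of i i] that len by auto
    moreover have "(ws ! i) \<bullet>c (ws ! i) = complex_of_real (r i)"
      using wsc[OF that] ip[OF that that] by (auto simp: scalar_prod_def lessThan_atLeast0)
    ultimately have "r i \<noteq> 0" by auto
    moreover have "r i \<ge> 0" by (auto simp: r_def intro: sum_nonneg)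
    ultimately show ?thesis by simp
  qed
  define W where "W = mat n n (\<lambda>(l,i). complex_of_real (1 / sqrt (r i)) * (ws ! i) $ l)"
  have Wc: "W \<in> carrier_mat n n" by (simp add: W_def)
  have "mat_adjoint W * W = 1\<^sub>m n"
  proof (rule eq_matI)
    fix i j assume "i < dim_row (1\<^sub>m n :: complex mat)" "j < dim_col (1\<^sub>m n :: complex mat)"
    hence ij: "i < n" "j < n" by auto
    have "(mat_adjoint W * W) $$ (i,j) = (\<Sum>l<n. cnj (W $$ (l,i)) * W $$ (l,j))"
      by (simp add: mat_mult_index[OF mat_adjoint_carrier[OF Wc] Wc ij] mat_adjoint_index[OF Wc ij(1)])
    also have "\<dots> = complex_of_real (1 / sqrt (r i)) * complex_of_real (1 / sqrt (r j)) *
        (\<Sum>l<n. (ws ! j) $ l * cnj ((ws ! i) $ l))"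
      unfolding sum_distrib_left by (rule sum.cong) (use ij in \<open>auto simp: W_def\<close>)
    also have "\<dots> = (1\<^sub>m n) $$ (i,j)"
      using ij r0[OF ij(1)] ip[OF ij]
      by (auto simp: field_simps simp flip: of_real_mult)
    finally show "(mat_adjoint W * W) $$ (i,j) = (1\<^sub>m n) $$ (i,j)" .
  qed (use Wc mat_adjoint_carrier[OF Wc] in auto)
  hence "unitary n W" using Wc by (simp add: unitary_def)
  moreover have "col W 0 = complex_of_real (1 / sqrt (r 0)) \<cdot>\<^sub>v v"
    using n v(1) by (intro eq_vecI) (auto simp: W_def ws0)
  ultimately show ?thesis by (rule that)
qed

lemma mat_adjoint_block_diag:
  fixes P Q :: "complex mat"
  assumes P: "P \<in> carrier_mat n n" and Q: "Q \<in> carrier_mat m m"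
  shows "mat_adjoint (four_block_mat P (0\<^sub>m n m) (0\<^sub>m m n) Q)
       = four_block_mat (mat_adjoint P) (0\<^sub>m n m) (0\<^sub>m m n) (mat_adjoint Q)" (is "?L = ?R")
proof (rule eq_matI)
  have B: "four_block_mat P (0\<^sub>m n m) (0\<^sub>m m n) Q \<in> carrier_mat (n+m) (n+m)" using P Q by simp
  have L: "?L \<in> carrier_mat (n+m) (n+m)" by (rule mat_adjoint_carrier[OF B])
  have R: "?R \<in> carrier_mat (n+m) (n+m)"
    using mat_adjoint_carrier[OF P] mat_adjoint_carrier[OF Q] by simp
  show "dim_row ?L = dim_row ?R" "dim_col ?L = dim_col ?R" using L R by auto
  fix i j assume "i < dim_row ?R" "j < dim_col ?R"
  hence ij: "i < n + m" "j < n + m" using R by auto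
  show "?L $$ (i,j) = ?R $$ (i,j)"
    using ij P Q mat_adjoint_carrier[OF P] mat_adjoint_carrier[OF Q]
    by (auto simp: mat_adjoint_index[OF B ij] mat_adjoint_index[OF P] mat_adjoint_index[OF Q])
qed

lemma block_diag_mult:
  fixes P Q P' Q' :: "complex mat"
  assumes "P \<in> carrier_mat n n" "P' \<in> carrier_mat n n" "Q \<in> carrier_mat m m" "Q' \<in> carrier_mat m m"
  shows "four_block_mat P (0\<^sub>m n m) (0\<^sub>m m n) Q * four_block_mat P' (0\<^sub>m n m) (0\<^sub>m m n) Q'
       = four_block_mat (P * P') (0\<^sub>m n m) (0\<^sub>m m n) (Q * Q')"
  using assms by (subst mult_four_block_mat[of P n n _ m _ m _ P' n _ m]) auto

text \<open>
  Induction on the list of roots: in an orthonormal basis that starts with an eigenvector for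
  the first root, the first column of \<open>A\<close> vanishes off the diagonal, hence by symmetry so
  does the first row, and the remaining block is Hermitian with the remaining roots.  Keeping
  the given order of the roots allows eigenvalues to be listed by value or by modulus later on.
\<close>
theorem hermitian_unitarily_diagonalizable:
  assumes "A \<in> carrier_mat n n" "mat_adjoint A = A" "char_poly A = (\<Prod>e\<leftarrow>es. [:- e, 1:])"
  shows "\<exists>V. unitary n V \<and> A = unitary_diag n V (\<lambda>i. es ! i)"
  using assms
proof (induction es arbitrary: n A)
  case Nil
  hence "n = 0" using degree_monic_char_poly[of A n] by auto
  hence "unitary n (1\<^sub>m n)" "A = unitary_diag n (1\<^sub>m n) (\<lambda>i. [] ! i)"
    using Nil.prems(1) by (auto simp: unitary_def unitary_diag_def mat_adjoint_def mat_diag_def intro!: eq_matI)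
  thus ?case by blast
next
  case (Cons e es)
  note A = Cons.prems(1)
  have cp: "char_poly A = [:-e,1:] * (\<Prod>e\<leftarrow>es. [:- e, 1:])" using Cons.prems(3) by simp
  have "degree (char_poly A) = Suc (length es)"
    unfolding Cons.prems(3) using degree_linear_factors[of uminus "e # es"] by (simp del: prod_list.Cons list.map)
  hence n: "n = Suc (length es)" using degree_monic_char_poly[OF A] by simp
  define m where "m = length es"
  have nm: "n = 1 + m" using n by (simp add: m_def)
  have n0: "0 < n" using n by simp
  have "eigenvalue A e" unfolding eigenvalue_root_char_poly[OF A] cp by simp
  then obtain v where v: "v \<in> carrier_vec n" "v \<noteq> 0\<^sub>v n" "A *\<^sub>v v = e \<cdot>\<^sub>v v"
    using A unfolding eigenvalue_def eigenvector_def by auto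
  obtain W c where W: "unitary n W" and W0: "col W 0 = c \<cdot>\<^sub>v v"
    using unitary_first_column[OF v(1,2)] .
  note Wc = unitary_carrier[OF W] unitary_adjoint_carrier[OF W]
  define A' where "A' = mat_adjoint W * (A * W)"
  have A': "A' \<in> carrier_mat n n" using A Wc by (auto simp: A'_def)
  have AW: "A * W \<in> carrier_mat n n" using A Wc by auto
  have herm: "mat_adjoint A' = A'"
    using A Wc Cons.prems(2)
    by (simp add: A'_def mat_adjoint_mult[of _ n n _ n] mat_adjoint_adjoint[of _ n n] mat_assoc[of _ n])
  \<comment> \<open>Conjugating by W leaves e times the first unit vector as first column.\<close>
  have "col (A * W) 0 = e \<cdot>\<^sub>v col W 0"
  proof -
    have "col (A * W) 0 = A *\<^sub>v col W 0" by (rule col_mult2[OF A Wc(1) n0])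
    also have "\<dots> = c \<cdot>\<^sub>v (e \<cdot>\<^sub>v v)" unfolding W0 by (simp only: mult_mat_vec[OF A v(1)] v(3))
    also have "\<dots> = e \<cdot>\<^sub>v col W 0" unfolding W0 by (simp add: smult_smult_assoc mult.commute)
    finally show ?thesis .
  qed
  hence AW0: "(A * W) $$ (l,0) = e * W $$ (l,0)" if "l < n" for l
    using that AW Wc n by (metis carrier_matD col_def index_col index_smult_vec(1) zero_less_Suc index_vec dim_col)
  have A'0: "A' $$ (i,0) = (if i = 0 then e else 0)" if "i < n" for i
  proof -
    have "A' $$ (i,0) = e * (mat_adjoint W * W) $$ (i,0)"
      using that n0 unfolding A'_def
      by (simp add: mat_mult_index[OF Wc(2) AW] mat_mult_index[OF Wc(2,1)] AW0 sum_distrib_left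
          mult.left_commute del: sum.lessThan_Suc)
    thus ?thesis using that n by (simp add: unitary_left[OF W])
  qed
  have A'0': "A' $$ (0,i) = 0" if "i < n" "i \<noteq> 0" for i
  proof -
    have "A' $$ (0,i) = cnj (A' $$ (i,0))" using mat_adjoint_index[OF A', of 0 i] herm that n by simp
    thus ?thesis using A'0[OF that(1)] that(2) by simp
  qed
  define A3 where "A3 = mat m m (\<lambda>(i,j). A' $$ (Suc i, Suc j))"
  have A3: "A3 \<in> carrier_mat m m" by (simp add: A3_def)
  define E where "E = mat 1 1 (\<lambda>_. e)"
  have E: "E \<in> carrier_mat 1 1" by (simp add: E_def)
  have A'b: "A' = four_block_mat E (0\<^sub>m 1 m) (0\<^sub>m m 1) A3"
    using A' by (intro eq_matI) (auto simp: E_def A3_def nm A'0 A'0')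
  have "similar_mat A' A" unfolding similar_mat_def
    by (rule exI[of _ "mat_adjoint W"], rule exI[of _ W], rule similar_mat_witI[of _ _ n])
       (use Wc A A' in \<open>auto simp: unitary_left[OF W] unitary_right[OF W] A'_def mat_assoc[of _ n]\<close>)
  hence "[:-e,1:] * (\<Prod>e\<leftarrow>es. [:- e, 1:]) = char_poly A'"
    using char_poly_similar cp by metis
  also have "\<dots> = char_poly E * char_poly A3"
    unfolding A'b by (rule char_poly_four_block_zeros_col[OF E _ A3]) auto
  also have "char_poly E = [:-e,1:]" by (simp add: E_def char_poly_defs det_def sign_def)
  finally have cp3: "char_poly A3 = (\<Prod>e\<leftarrow>es. [:- e, 1:])"
    by (metis mult_cancel_left pCons_eq_0_iff zero_neq_one)
  have herm3: "mat_adjoint A3 = A3"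
  proof (rule eq_matI)
    fix i j assume "i < dim_row A3" "j < dim_col A3"
    hence ij: "i < m" "j < m" using A3 by auto
    have "A' $$ (Suc i, Suc j) = cnj (A' $$ (Suc j, Suc i))"
      using mat_adjoint_index[OF A', of "Suc i" "Suc j"] ij nm herm by simp
    thus "mat_adjoint A3 $$ (i,j) = A3 $$ (i,j)"
      using ij by (simp only: mat_adjoint_index[OF A3 ij]) (simp add: A3_def)
  qed (use A3 mat_adjoint_carrier[OF A3] in auto)
  from Cons.IH[OF A3 herm3 cp3] obtain V3
    where V3: "unitary m V3" and A3e: "A3 = unitary_diag m V3 (\<lambda>i. es ! i)" by blast
  note V3c = unitary_carrier[OF V3] unitary_adjoint_carrier[OF V3]
  define V' where "V' = four_block_mat (1\<^sub>m 1) (0\<^sub>m 1 m) (0\<^sub>m m 1) V3"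
  have V'c: "V' \<in> carrier_mat n n" unfolding V'_def nm by (rule four_block_carrier_mat) (use V3c in auto)
  have adj1: "mat_adjoint (1\<^sub>m k) = (1\<^sub>m k :: complex mat)" for k
    using mat_adjoint_diag[of k "\<lambda>_. 1"] by simp
  have V'adj: "mat_adjoint V' = four_block_mat (1\<^sub>m 1) (0\<^sub>m 1 m) (0\<^sub>m m 1) (mat_adjoint V3)"
    unfolding V'_def using V3c by (subst mat_adjoint_block_diag) (auto simp: adj1)
  have "mat_adjoint V' * V' = 1\<^sub>m n"
    unfolding V'adj unfolding V'_def using V3c
    by (subst block_diag_mult) (auto simp: unitary_left[OF V3] nm)
  hence V': "unitary n V'" using V'c by (simp add: unitary_def)
  have D: "mat_diag n (\<lambda>i. (e # es) ! i)
      = four_block_mat E (0\<^sub>m 1 m) (0\<^sub>m m 1) (mat_diag m (\<lambda>i. es ! i))"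
    by (rule eq_matI) (auto simp: mat_diag_def E_def nm nth_Cons')
  have A'e: "A' = unitary_diag n V' (\<lambda>i. (e # es) ! i)"
    unfolding unitary_diag_def V'adj D unfolding V'_def A'b A3e unitary_diag_def using V3c E
    by (subst block_diag_mult, simp, simp, simp, simp, subst block_diag_mult) auto
  have "A = W * A' * mat_adjoint W"
    using Wc A by (simp add: A'_def mat_assoc[of _ n] unitary_cancel[OF W] unitary_right[OF W])
  also have "\<dots> = unitary_diag n (W * V') (\<lambda>i. (e # es) ! i)"
    unfolding A'e unitary_diag_def using Wc V'c mat_adjoint_carrier[OF V'c]
    by (simp add: mat_adjoint_mult[of W n n V' n] mat_assoc[of _ n])
  finally show ?case using unitary_mult[OF W V'] by blast
qed

section \<open>Eigenvalues, singular values and exponentials\<close>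

lemma char_poly_unitary_diag:
  assumes V: "unitary n V"
  shows "char_poly (unitary_diag n V d) = (\<Prod>e\<leftarrow>map d [0..<n]. [:- e, 1:])"
proof -
  note c = unitary_carrier[OF V] unitary_adjoint_carrier[OF V]
  have "similar_mat (unitary_diag n V d) (mat_diag n d)"
    unfolding similar_mat_def
    by (rule exI[of _ V], rule exI[of _ "mat_adjoint V"], rule similar_mat_witI[of _ _ n])
       (use c in \<open>auto simp: unitary_left[OF V] unitary_right[OF V] unitary_diag_def\<close>)
  hence "char_poly (unitary_diag n V d) = char_poly (mat_diag n d)" by (rule char_poly_similar)
  also have "\<dots> = (\<Prod>e\<leftarrow>diag_mat (mat_diag n d). [:- e, 1:])"
    by (rule char_poly_upper_triangular[OF mat_diag_dim]) (auto simp: mat_diag_def)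
  also have "diag_mat (mat_diag n d) = map d [0..<n]"
    by (auto simp: diag_mat_def mat_diag_def)
  finally show ?thesis .
qed

lemma proots_linear_factors: "proots (\<Prod>e\<leftarrow>es. [:- e, 1:]) = mset (es :: complex list)"
proof (induction es)
  case (Cons e es)
  have "(\<Prod>e\<leftarrow>es. [:- e, 1:]) \<noteq> 0" by (auto simp: prod_list_zero_iff)
  hence "proots ([:- e, 1:] * (\<Prod>e\<leftarrow>es. [:- e, 1:])) = {#e#} + mset es"
    by (subst proots_mult) (use Cons.IH proots_linear_factor[of "- e"] in auto)
  thus ?case by simp
qed simp

text \<open>
  Discards the rearrangements that the definitions of eigenvalue lists and of
  submajorization perform, for lists that are already non-increasing.
\<close>
lemma rev_sort_antitone:
  fixes f :: "nat \<Rightarrow> real"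
  assumes "\<And>i j. i \<le> j \<Longrightarrow> j < n \<Longrightarrow> f j \<le> f i"
  shows "rev (sort (map f [0..<n])) = map f [0..<n]"
proof -
  have "sorted (rev (map f [0..<n]))"
    unfolding sorted_wrt_rev using assms by (simp add: sorted_wrt_iff_nth_less)
  hence "sort (map f [0..<n]) = rev (map f [0..<n])" by (intro properties_for_sort) auto
  thus ?thesis by simp
qed

lemma eigenvalues_desc_unitary_diag:
  assumes "unitary n V"
  shows "eigenvalues_desc (unitary_diag n V (\<lambda>i. complex_of_real (d i))) = rev (sort (map d [0..<n]))"
proof -
  have "image_mset Re (proots (char_poly (unitary_diag n V (\<lambda>i. complex_of_real (d i)))))
      = mset (map d [0..<n])"
    unfolding char_poly_unitary_diag[OF assms] proots_linear_factors by (simp flip: mset_map add: comp_def)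
  thus ?thesis unfolding eigenvalues_desc_def by (simp only: sorted_list_of_multiset_mset)
qed

text \<open>
  The sorting key is the identity when the spread of the matrix is needed, and the absolute
  value when its singular values are.
\<close>
lemma hermitian_spectral:
  fixes key :: "real \<Rightarrow> real"
  assumes A: "A \<in> carrier_mat n n" and herm: "hermitian_mat A"
  obtains V d where "unitary n V" "A = unitary_diag n V (\<lambda>i. complex_of_real (d i))"
    "\<And>i j. i \<le> j \<Longrightarrow> j < n \<Longrightarrow> key (d j) \<le> key (d i)"
proof -
  have adj: "mat_adjoint A = A" using herm by (simp add: hermitian_mat_def)
  obtain es where es: "char_poly A = (\<Prod>e\<leftarrow>es. [:- e, 1:])" "length es = n"
    using char_poly_factorized[OF A] by blast
  define es' where "es' = rev (sort_key (\<lambda>e. key (Re e)) es)"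
  have "mset es' = mset es" by (simp add: es'_def)
  hence "(\<Prod>e\<leftarrow>es'. [:- e, 1:]) = (\<Prod>e\<leftarrow>es. [:- e, 1:])"
    by (metis mset_map prod_mset_prod_list)
  hence cp: "char_poly A = (\<Prod>e\<leftarrow>es'. [:- e, 1:])" using es by simp
  obtain V where V: "unitary n V" and AV: "A = unitary_diag n V (\<lambda>i. es' ! i)"
    using hermitian_unitarily_diagonalizable[OF A adj cp] by blast
  define d where "d i = Re (es' ! i)" for i
  have diag: "mat_diag n (\<lambda>i. cnj (es' ! i)) = mat_diag n (\<lambda>i. es' ! i)"
    using adj unfolding AV unitary_diag_adjoint[OF V] by (metis unitary_diag_diagonalize[OF V])
  have real: "cnj (es' ! i) = es' ! i" if "i < n" for i
    using arg_cong[OF diag, of "\<lambda>M. M $$ (i,i)"] that by (simp add: mat_diag_def)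
  have "A = unitary_diag n V (\<lambda>i. complex_of_real (d i))"
    unfolding AV by (rule unitary_diag_cong) (metis real d_def Reals_cnj_iff of_real_Re)
  moreover have "key (d j) \<le> key (d i)" if "i \<le> j" "j < n" for i j
  proof -
    have "sorted (map (\<lambda>e. key (Re e)) (rev es'))" by (simp add: es'_def)
    hence "sorted_wrt (\<lambda>x y. key (Re y) \<le> key (Re x)) es'"
      by (simp add: rev_map sorted_wrt_rev sorted_wrt_map)
    thus ?thesis using that es(2) mset_eq_length[OF \<open>mset es' = mset es\<close>]
      by (cases "i = j") (auto simp: sorted_wrt_iff_nth_less d_def)
  qed
  ultimately show ?thesis using that V by blast
qed

lemma unitary_diag_quadratic_form:
  assumes V: "unitary n V" and v: "v \<in> carrier_vec n"
  shows "Re ((unitary_diag n V (\<lambda>i. complex_of_real (d i)) *\<^sub>v v) \<bullet>c v)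
       = (\<Sum>l<n. d l * (cmod (\<Sum>j<n. cnj (V $$ (j,l)) * v $ j))\<^sup>2)"
proof -
  let ?B = "unitary_diag n V (\<lambda>i. complex_of_real (d i))"
  define y where "y l = (\<Sum>j<n. cnj (V $$ (j,l)) * v $ j)" for l
  note B = unitary_diag_carrier[OF V]
  have "(?B *\<^sub>v v) \<bullet>c v = (\<Sum>i<n. (\<Sum>j<n. ?B $$ (i,j) * v $ j) * cnj (v $ i))"
    using B[of "\<lambda>i. complex_of_real (d i)"] v by (auto simp: scalar_prod_def lessThan_atLeast0)
  also have "\<dots> = (\<Sum>i<n. \<Sum>j<n. \<Sum>l<n. V $$ (i,l) * d l * cnj (V $$ (j,l)) * v $ j * cnj (v $ i))"
    by (intro sum.cong refl) (simp add: unitary_diag_index[OF V] sum_distrib_right sum_distrib_left)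
  also have "\<dots> = (\<Sum>i<n. \<Sum>l<n. \<Sum>j<n. V $$ (i,l) * d l * cnj (V $$ (j,l)) * v $ j * cnj (v $ i))"
    by (rule sum.cong[OF refl], rule sum.swap)
  also have "\<dots> = (\<Sum>l<n. \<Sum>i<n. \<Sum>j<n. V $$ (i,l) * d l * cnj (V $$ (j,l)) * v $ j * cnj (v $ i))"
    by (rule sum.swap)
  also have "\<dots> = (\<Sum>l<n. d l * (y l * cnj (y l)))"
  proof (rule sum.cong[OF refl])
    fix l
    have "y l * cnj (y l)
        = (\<Sum>j<n. \<Sum>i<n. (cnj (V $$ (j,l)) * v $ j) * (V $$ (i,l) * cnj (v $ i)))"
      by (simp add: y_def sum_product)
    also have "\<dots> = (\<Sum>i<n. \<Sum>j<n. (cnj (V $$ (j,l)) * v $ j) * (V $$ (i,l) * cnj (v $ i)))"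
      by (rule sum.swap)
    finally show "(\<Sum>i<n. \<Sum>j<n. V $$ (i,l) * d l * cnj (V $$ (j,l)) * v $ j * cnj (v $ i))
        = d l * (y l * cnj (y l))"
      by (simp add: sum_distrib_left mult_ac)
  qed
  also have "\<dots> = complex_of_real (\<Sum>l<n. d l * (cmod (y l))\<^sup>2)"
    by (simp only: of_real_sum of_real_mult complex_norm_square)
  finally show ?thesis by (simp add: y_def)
qed

lemma psd_unitary_diag_iff:
  assumes V: "unitary n V"
  shows "psd_mat (unitary_diag n V (\<lambda>i. complex_of_real (d i))) \<longleftrightarrow> (\<forall>i<n. 0 \<le> d i)"
proof
  note c = unitary_carrier[OF V] unitary_adjoint_carrier[OF V]
  let ?B = "unitary_diag n V (\<lambda>i. complex_of_real (d i))"
  have dim: "dim_row ?B = n" using unitary_diag_carrier[OF V] by auto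
  {
    assume "psd_mat ?B"
    show "\<forall>i<n. 0 \<le> d i"
    proof (intro allI impI)
      fix i assume i: "i < n"
      have v: "col V i \<in> carrier_vec n" using c i by auto
      have "(\<Sum>j<n. cnj (V $$ (j,l)) * col V i $ j) = (if l = i then 1 else 0)" if "l < n" for l
      proof -
        have "(\<Sum>j<n. cnj (V $$ (j,l)) * col V i $ j) = (mat_adjoint V * V) $$ (l,i)"
          unfolding mat_mult_index[OF c(2,1) that i]
          using c i that by (simp add: mat_adjoint_index[OF c(1)])
        thus ?thesis using i that by (simp add: unitary_left[OF V])
      qed
      hence "Re ((?B *\<^sub>v col V i) \<bullet>c col V i) = (\<Sum>l<n. d l * (cmod (if l = i then 1 else 0))\<^sup>2)"
        unfolding unitary_diag_quadratic_form[OF V v] by (intro sum.cong refl) simp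
      also have "\<dots> = d i"
        using i by (simp add: if_distrib[of "\<lambda>x. _ * x"] if_distrib[of "\<lambda>x. (cmod x)\<^sup>2"] cong: if_cong)
      finally show "0 \<le> d i" using \<open>psd_mat ?B\<close> v unfolding psd_mat_def dim by metis
    qed
  next
    assume "\<forall>i<n. 0 \<le> d i"
    moreover have "mat_adjoint ?B = ?B" by (simp add: unitary_diag_adjoint[OF V])
    ultimately show "psd_mat ?B"
      unfolding psd_mat_def dim hermitian_mat_def
      by (auto simp: unitary_diag_quadratic_form[OF V] intro!: sum_nonneg)
  }
qed

text \<open>
  For uniqueness, let \<open>B\<close> be a positive square root with eigenbasis \<open>W\<close> and eigenvalues \<open>e\<close>.
  The matrix \<open>W\<^sup>*V\<close> intertwines \<open>e\<^sup>2\<close> with \<open>d\<^sup>2\<close>, so its entries vanish unless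
  \<open>e i ^ 2 = d j ^ 2\<close>.  For nonnegative numbers this means \<open>e i = d j\<close>, so it intertwines \<open>e\<close> with
  \<open>d\<close> too.
\<close>
lemma psd_sqrt_unitary_diag:
  assumes V: "unitary n V" and d: "\<And>i. i < n \<Longrightarrow> 0 \<le> d i"
  shows "psd_sqrt (unitary_diag n V (\<lambda>i. complex_of_real ((d i)\<^sup>2)))
    = unitary_diag n V (\<lambda>i. complex_of_real (d i))"
    (is "psd_sqrt ?A = ?R")
proof -
  have A: "?A \<in> carrier_mat n n" by (rule unitary_diag_carrier[OF V])
  have dim: "dim_row ?A = n" using A by auto
  have R: "?R \<in> carrier_mat n n" by (rule unitary_diag_carrier[OF V])
  show ?thesis unfolding psd_sqrt_def dim
  proof (rule the_equality, intro conjI)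
    show "?R \<in> carrier_mat n n" by (rule R)
    show "psd_mat ?R" using d by (simp add: psd_unitary_diag_iff[OF V])
    show "?R * ?R = ?A" by (simp add: unitary_diag_mult[OF V] power2_eq_square)
    fix B assume B: "B \<in> carrier_mat n n \<and> psd_mat B \<and> B * B = ?A"
    hence "hermitian_mat B" by (simp add: psd_mat_def)
    then obtain W e where W: "unitary n W" and BW: "B = unitary_diag n W (\<lambda>i. complex_of_real (e i))"
      using hermitian_spectral[of B n "\<lambda>x. x"] B by metis
    have e: "0 \<le> e i" if "i < n" for i using B that unfolding BW psd_unitary_diag_iff[OF W] by simp
    note c = unitary_carrier[OF V] unitary_adjoint_carrier[OF V]
      unitary_carrier[OF W] unitary_adjoint_carrier[OF W]
    define M where "M = mat_adjoint W * V"
    have M: "M \<in> carrier_mat n n" using c by (simp add: M_def)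
    have move: "mat_adjoint W * (unitary_diag n W f * V) = mat_diag n f * M"
      "mat_adjoint W * (unitary_diag n V f * V) = M * mat_diag n f" for f
      using c by (simp_all add: unitary_diag_def M_def mat_assoc[of _ n] unitary_cancel[OF W]
          unitary_left[OF V] right_mult_one_mat[OF mat_diag_dim])
    have "unitary_diag n W (\<lambda>i. complex_of_real ((e i)\<^sup>2)) = ?A"
      using B unfolding BW unitary_diag_mult[OF W] by (simp add: power2_eq_square)
    hence comm: "mat_diag n (\<lambda>i. complex_of_real ((e i)\<^sup>2)) * M
        = M * mat_diag n (\<lambda>i. complex_of_real ((d i)\<^sup>2))"
      using move by metis
    have "mat_diag n (\<lambda>i. complex_of_real (e i)) * M = M * mat_diag n (\<lambda>i. complex_of_real (d i))"
      unfolding mat_diag_mult_left[OF M] mat_diag_mult_right[OF M]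
    proof (rule cong_mat)
      fix i j assume ij: "i < n" "j < n"
      have "complex_of_real ((e i)\<^sup>2) * M $$ (i,j) = M $$ (i,j) * complex_of_real ((d j)\<^sup>2)"
        using arg_cong[OF comm, of "\<lambda>X. X $$ (i,j)"] ij
        unfolding mat_diag_mult_left[OF M] mat_diag_mult_right[OF M] by simp
      hence "M $$ (i,j) = 0 \<or> complex_of_real ((e i)\<^sup>2) = complex_of_real ((d j)\<^sup>2)" by auto
      hence "M $$ (i,j) = 0 \<or> e i = d j"
        using e[OF ij(1)] d[OF ij(2)] unfolding of_real_eq_iff by auto
      thus "(case (i,j) of (i,j) \<Rightarrow> complex_of_real (e i) * M $$ (i,j))
          = (case (i,j) of (i,j) \<Rightarrow> M $$ (i,j) * complex_of_real (d j))" by auto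
    qed auto
    hence "mat_adjoint W * (B * V) = mat_adjoint W * (?R * V)" unfolding BW move .
    hence "W * (mat_adjoint W * (B * V)) * mat_adjoint V = W * (mat_adjoint W * (?R * V)) * mat_adjoint V"
      by simp
    moreover have "B \<in> carrier_mat n n" using B by simp
    ultimately show "B = ?R"
      using c R by (simp add: unitary_cancel[OF W] mat_assoc[of _ n] unitary_right[OF V]
          right_mult_one_mat[of _ n n])
  qed
qed

lemma singular_values_unitary_diag:
  assumes V: "unitary n V"
  shows "singular_values (unitary_diag n V (\<lambda>i. complex_of_real (d i))) = rev (sort (map (\<lambda>i. \<bar>d i\<bar>) [0..<n]))"
proof -
  have "mat_adjoint (unitary_diag n V (\<lambda>i. complex_of_real (d i))) * unitary_diag n V (\<lambda>i. complex_of_real (d i))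
      = unitary_diag n V (\<lambda>i. complex_of_real (\<bar>d i\<bar>\<^sup>2))"
    by (simp add: unitary_diag_adjoint[OF V] unitary_diag_mult[OF V] power2_eq_square)
  thus ?thesis unfolding singular_values_def
    by (simp only: psd_sqrt_unitary_diag[OF V abs_ge_zero] eigenvalues_desc_unitary_diag[OF V])
qed

lemma unitary_diag_smult: "unitary n V \<Longrightarrow> s \<cdot>\<^sub>m unitary_diag n V d = unitary_diag n V (\<lambda>i. s * d i)"
proof -
  assume V: "unitary n V"
  have c: "unitary_diag n V f \<in> carrier_mat n n" for f by (rule unitary_diag_carrier[OF V])
  show ?thesis
    using c[of d] c[of "\<lambda>i. s * d i"]
    by (intro eq_matI) (auto simp: unitary_diag_index[OF V] sum_distrib_left mult_ac)
qed

lemma unitary_diag_power: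
  assumes V: "unitary n V"
  shows "unitary_diag n V d ^\<^sub>m k = unitary_diag n V (\<lambda>i. d i ^ k)"
proof (induction k)
  case 0
  have "dim_row (unitary_diag n V d) = n" using unitary_diag_carrier[OF V] by auto
  thus ?case by (simp add: unitary_diag_one[OF V])
next
  case (Suc k)
  thus ?case by (simp add: unitary_diag_mult[OF V] mult.commute)
qed

lemma mat_exp_unitary_diag:
  assumes V: "unitary n V"
  shows "mat_exp (unitary_diag n V d) = unitary_diag n V (\<lambda>i. exp (d i))"
proof (rule eq_matI)
  have c: "unitary_diag n V f \<in> carrier_mat n n" for f by (rule unitary_diag_carrier[OF V])
  show "dim_row (mat_exp (unitary_diag n V d)) = dim_row (unitary_diag n V (\<lambda>i. exp (d i)))"
    "dim_col (mat_exp (unitary_diag n V d)) = dim_col (unitary_diag n V (\<lambda>i. exp (d i)))"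
    using c[of d] c[of "\<lambda>i. exp (d i)"] by (auto simp: mat_exp_def)
  fix i j assume "i < dim_row (unitary_diag n V (\<lambda>i. exp (d i)))" "j < dim_col (unitary_diag n V (\<lambda>i. exp (d i)))"
  hence ij: "i < n" "j < n" using c[of "\<lambda>i. exp (d i)"] by auto
  have "(\<lambda>k. \<Sum>l<n. V $$ (i,l) * cnj (V $$ (j,l)) * (d l ^ k /\<^sub>R fact k))
      sums (\<Sum>l<n. V $$ (i,l) * cnj (V $$ (j,l)) * exp (d l))"
    by (intro sums_sum sums_mult exp_converges)
  also have "(\<lambda>k. \<Sum>l<n. V $$ (i,l) * cnj (V $$ (j,l)) * (d l ^ k /\<^sub>R fact k))
      = (\<lambda>k. (unitary_diag n V d ^\<^sub>m k) $$ (i,j) / fact k)"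
    by (rule ext) (simp add: unitary_diag_power[OF V] unitary_diag_index[OF V ij] sum_divide_distrib
        scaleR_conv_of_real field_simps)
  finally have "(\<Sum>k. (unitary_diag n V d ^\<^sub>m k) $$ (i,j) / fact k)
      = (\<Sum>l<n. V $$ (i,l) * cnj (V $$ (j,l)) * exp (d l))"
    by (simp add: sums_iff)
  thus "mat_exp (unitary_diag n V d) $$ (i,j) = unitary_diag n V (\<lambda>i. exp (d i)) $$ (i,j)"
    using ij c[of d] by (simp add: mat_exp_def unitary_diag_index[OF V] mult_ac)
qed

text \<open>
  The spectrum of \<open>A \<oplus> A\<close> repeats every eigenvalue twice, so position \<open>i\<close> of its sorted
  list holds the eigenvalue number \<open>i div 2\<close> of \<open>A\<close>.
\<close>
lemma mset_doubled: "mset (map f [0..<n]) + mset (map f [0..<n]) = mset (map (\<lambda>i. f (i div 2)) [0..<2*n])"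
  by (induction n) (simp_all add: algebra_simps)

lemma spectral_spread_direct_sum:
  assumes V: "unitary n V" and d: "\<And>i j. i \<le> j \<Longrightarrow> j < n \<Longrightarrow> d j \<le> d i"
  defines "A \<equiv> unitary_diag n V (\<lambda>i. complex_of_real (d i))"
  shows "spectral_spread (direct_sum_mat A A)
       = map (\<lambda>i. d (i div 2) - d (n - 1 - i div 2)) [0..<n]"
proof -
  have A: "A \<in> carrier_mat n n" unfolding A_def by (rule unitary_diag_carrier[OF V])
  have ds: "direct_sum_mat A A = four_block_mat A (0\<^sub>m n n) (0\<^sub>m n n) A"
    using A by (simp add: direct_sum_mat_def)
  have dim: "dim_row (direct_sum_mat A A) = 2 * n" unfolding ds using A by auto
  note cpA = char_poly_unitary_diag[OF V, of "\<lambda>i. complex_of_real (d i)", folded A_def]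
  have ex: "\<exists>es. char_poly A = (\<Prod>e\<leftarrow>es. [:- e, 1:])" using cpA by blast
  have "char_poly (direct_sum_mat A A) = char_poly A * char_poly A"
    by (rule char_poly_0_block[OF ds ex ex A _ A]) simp
  also have "\<dots> = (\<Prod>e\<leftarrow>map (\<lambda>i. complex_of_real (d i)) [0..<n] @
      map (\<lambda>i. complex_of_real (d i)) [0..<n]. [:- e, 1:])"
    unfolding cpA by simp
  finally have "image_mset Re (proots (char_poly (direct_sum_mat A A)))
      = mset (map d [0..<n]) + mset (map d [0..<n])"
    by (simp only: proots_linear_factors mset_append image_mset_union mset_map[symmetric])
       (simp add: comp_def)
  hence e: "eigenvalues_desc (direct_sum_mat A A) = map (\<lambda>i. d (i div 2)) [0..<2*n]"
    unfolding mset_doubled eigenvalues_desc_def sorted_list_of_multiset_mset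
    by (simp only: sorted_list_of_multiset_mset) (rule rev_sort_antitone, rule d, auto)
  show ?thesis unfolding spectral_spread_def Let_def e dim
  proof (rule map_cong)
    fix i assume "i \<in> set [0..<n]"
    hence i: "i < n" by simp
    have "(2 * n - 1 - i) div 2 = n - 1 - i div 2" using i by linarith
    thus "map (\<lambda>i. d (i div 2)) [0..<2*n] ! i - map (\<lambda>i. d (i div 2)) [0..<2*n] ! (2*n - 1 - i)
        = d (i div 2) - d (n - 1 - i div 2)"
      using i by simp
  qed simp
qed

section \<open>The commutator as a trilinear form in spectral weights\<close>

text \<open>
  For the \<open>i\<close>-th, \<open>j\<close>-th and \<open>l\<close>-th columns \<open>u, v, w\<close> of \<open>U, V, W\<close>, this is the trace of
  \<open>i [u u\<^sup>*, v v\<^sup>*] w w\<^sup>*\<close>: the two terms of the commutator have complex conjugate traces.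
\<close>
definition triple_overlap :: "complex mat \<Rightarrow> complex mat \<Rightarrow> complex mat \<Rightarrow> nat \<Rightarrow> nat \<Rightarrow> nat \<Rightarrow> real" where
  "triple_overlap U V W i j l = - 2 * Im ((mat_adjoint U * V) $$ (i,j) * (mat_adjoint V * W) $$ (j,l)
     * (mat_adjoint W * U) $$ (l,i))"

text \<open>
  The trace \<open>tr(i[A,B] C)\<close> for \<open>A, B, C\<close> with eigenbases \<open>U, V, W\<close> and eigenvalues \<open>a, b, c\<close>.
  Being a finite sum, it is manifestly linear in each list of eigenvalues.
\<close>
definition commutator_form :: "nat \<Rightarrow> complex mat \<Rightarrow> complex mat \<Rightarrow> complex mat \<Rightarrow>
    (nat \<Rightarrow> real) \<Rightarrow> (nat \<Rightarrow> real) \<Rightarrow> (nat \<Rightarrow> real) \<Rightarrow> real" where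
  "commutator_form n U V W a b c = (\<Sum>i<n. \<Sum>j<n. \<Sum>l<n. a i * b j * c l * triple_overlap U V W i j l)"

lemma triple_overlap_rotate: "triple_overlap U V W i j l = triple_overlap V W U j l i"
  by (simp add: triple_overlap_def mult_ac)

lemma overlap_cnj:
  assumes "unitary n U" "unitary n V" "i < n" "j < n"
  shows "(mat_adjoint V * U) $$ (j,i) = cnj ((mat_adjoint U * V) $$ (i,j))"
proof -
  note c = unitary_carrier[OF assms(1)] unitary_carrier[OF assms(2)]
    unitary_adjoint_carrier[OF assms(1)] unitary_adjoint_carrier[OF assms(2)]
  have "mat_adjoint V * U = mat_adjoint (mat_adjoint U * V)"
    using c by (simp add: mat_adjoint_mult[of _ n n _ n] mat_adjoint_adjoint[of _ n n])
  thus ?thesis using c assms(3,4) by (simp add: mat_adjoint_index[of _ n n])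
qed

lemma triple_overlap_flip:
  assumes "unitary n U" "unitary n V" "unitary n W" "i < n" "j < n" "l < n"
  shows "triple_overlap V U W j i l = - triple_overlap U V W i j l"
  using assms by (simp add: triple_overlap_def overlap_cnj[of n U V i j] overlap_cnj[of n U W i l]
      overlap_cnj[of n W V l j] mult_ac flip: complex_cnj_mult) (simp add: algebra_simps)

lemma commutator_form_rotate: "commutator_form n U V W a b c = commutator_form n V W U b c a"
proof -
  have "commutator_form n U V W a b c = (\<Sum>j<n. \<Sum>i<n. \<Sum>l<n. a i * b j * c l * triple_overlap U V W i j l)"
    unfolding commutator_form_def by (rule sum.swap)
  also have "\<dots> = (\<Sum>j<n. \<Sum>l<n. \<Sum>i<n. a i * b j * c l * triple_overlap U V W i j l)"
    by (rule sum.cong[OF refl], rule sum.swap)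
  finally show ?thesis by (simp add: commutator_form_def triple_overlap_rotate[of U] mult_ac)
qed

lemma commutator_form_flip:
  assumes "unitary n U" "unitary n V" "unitary n W"
  shows "commutator_form n V U W b a c = - commutator_form n U V W a b c"
proof -
  have "commutator_form n V U W b a c = (\<Sum>i<n. \<Sum>j<n. \<Sum>l<n. b j * a i * c l * triple_overlap V U W j i l)"
    unfolding commutator_form_def by (rule sum.swap)
  also have "\<dots> = (\<Sum>i<n. \<Sum>j<n. \<Sum>l<n. - (a i * b j * c l * triple_overlap U V W i j l))"
    by (intro sum.cong refl) (simp add: triple_overlap_flip[OF assms])
  finally show ?thesis by (simp add: commutator_form_def sum_negf)
qed

lemma commutator_form_cong:
  assumes "\<And>i. i < n \<Longrightarrow> a i = a' i" "\<And>i. i < n \<Longrightarrow> b i = b' i" "\<And>i. i < n \<Longrightarrow> c i = c' i"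
  shows "commutator_form n U V W a b c = commutator_form n U V W a' b' c'"
  unfolding commutator_form_def using assms by (intro sum.cong refl) auto

lemma commutator_form_add: "commutator_form n U V W (\<lambda>i. a i + a' i) b c
    = commutator_form n U V W a b c + commutator_form n U V W a' b c"
  by (simp add: commutator_form_def sum.distrib distrib_right)

lemma commutator_form_scale: "commutator_form n U V W (\<lambda>i. r * a i) b c = r * commutator_form n U V W a b c"
  by (simp add: commutator_form_def sum_distrib_left mult.assoc)

lemma commutator_form_sum:
  "finite M \<Longrightarrow> commutator_form n U V W (\<lambda>i. \<Sum>m\<in>M. r m * a m i) b c
    = (\<Sum>m\<in>M. r m * commutator_form n U V W (a m) b c)"
proof (induction M rule: finite_induct)
  case empty
  show ?case by (simp add: commutator_form_def)
next
  case (insert x F)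
  then show ?case by (simp add: commutator_form_add commutator_form_scale)
qed

text \<open>
  A multiple of the identity commutes with every matrix.
\<close>
lemma commutator_form_const:
  assumes U: "unitary n U" and V: "unitary n V" and W: "unitary n W"
  shows "commutator_form n U V W (\<lambda>_. 1) b c = 0"
proof -
  note c = unitary_carrier[OF U] unitary_carrier[OF V] unitary_carrier[OF W]
    unitary_adjoint_carrier[OF U] unitary_adjoint_carrier[OF V] unitary_adjoint_carrier[OF W]
  have z: "(\<Sum>i<n. triple_overlap U V W i j l) = 0" if jl: "j < n" "l < n" for j l
  proof -
    let ?z = "(mat_adjoint V * W) $$ (j,l)"
    have "(\<Sum>i<n. (mat_adjoint W * U) $$ (l,i) * (mat_adjoint U * V) $$ (i,j))
        = ((mat_adjoint W * U) * (mat_adjoint U * V)) $$ (l,j)"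
      using c jl by (subst mat_mult_index[of _ n n _ n]) auto
    also have "(mat_adjoint W * U) * (mat_adjoint U * V) = mat_adjoint W * V"
      using c by (simp add: mat_assoc[of _ n] unitary_cancel[OF U])
    also have "\<dots> $$ (l,j) = cnj ?z" by (rule overlap_cnj[OF V W jl])
    finally have s: "(\<Sum>i<n. (mat_adjoint W * U) $$ (l,i) * (mat_adjoint U * V) $$ (i,j)) = cnj ?z" .
    have "(\<Sum>i<n. triple_overlap U V W i j l) = - 2 * Im (?z *
        (\<Sum>i<n. (mat_adjoint W * U) $$ (l,i) * (mat_adjoint U * V) $$ (i,j)))"
      unfolding triple_overlap_def sum_distrib_left Im_sum by (rule sum.cong) (simp_all add: algebra_simps)
    thus ?thesis unfolding s by simp
  qed
  have "commutator_form n U V W (\<lambda>_. 1) b c = commutator_form n V W U b c (\<lambda>_. 1)" by (rule commutator_form_rotate)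
  also have "\<dots> = (\<Sum>j<n. \<Sum>l<n. b j * c l * (\<Sum>i<n. triple_overlap U V W i j l))"
    by (simp add: commutator_form_def sum_distrib_left triple_overlap_rotate[of U])
  also have "\<dots> = 0" by (simp add: z)
  finally show ?thesis .
qed

lemma unitary_isometry:
  assumes "unitary n M"
  shows "(\<Sum>i<n. (cmod (\<Sum>j<n. M $$ (i,j) * z j))\<^sup>2) = (\<Sum>j<n. (cmod (z j))\<^sup>2)"
proof -
  note c = unitary_carrier[OF assms] unitary_adjoint_carrier[OF assms]
  have o: "(\<Sum>i<n. M $$ (i,j) * cnj (M $$ (i,k))) = (if k = j then 1 else 0)" if "j < n" "k < n" for j k
  proof -
    have "(mat_adjoint M * M) $$ (k,j) = (\<Sum>i<n. M $$ (i,j) * cnj (M $$ (i,k)))"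
      by (simp add: mat_mult_index[OF c(2,1) that(2,1)] mat_adjoint_index[OF c(1) that(2)] mult.commute)
    thus ?thesis using that by (simp add: unitary_left[OF assms])
  qed
  have "complex_of_real (\<Sum>i<n. (cmod (\<Sum>j<n. M $$ (i,j) * z j))\<^sup>2)
      = (\<Sum>i<n. (\<Sum>j<n. M $$ (i,j) * z j) * cnj (\<Sum>k<n. M $$ (i,k) * z k))"
    by (simp only: of_real_sum complex_norm_square)
  also have "\<dots> = (\<Sum>i<n. \<Sum>j<n. \<Sum>k<n. z j * cnj (z k) * (M $$ (i,j) * cnj (M $$ (i,k))))"
    by (simp add: sum_product mult_ac)
  also have "\<dots> = (\<Sum>j<n. \<Sum>i<n. \<Sum>k<n. z j * cnj (z k) * (M $$ (i,j) * cnj (M $$ (i,k))))"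
    by (rule sum.swap)
  also have "\<dots> = (\<Sum>j<n. \<Sum>k<n. \<Sum>i<n. z j * cnj (z k) * (M $$ (i,j) * cnj (M $$ (i,k))))"
    by (rule sum.cong[OF refl], rule sum.swap)
  also have "\<dots> = (\<Sum>j<n. \<Sum>k<n. z j * cnj (z k) * (if k = j then 1 else 0))"
    by (intro sum.cong refl) (simp add: o flip: sum_distrib_left)
  also have "\<dots> = (\<Sum>j<n. z j * cnj (z j))"
    by (simp add: if_distrib[of "\<lambda>x. _ * x"] cong: if_cong)
  also have "\<dots> = complex_of_real (\<Sum>j<n. (cmod (z j))\<^sup>2)"
    by (simp only: of_real_sum complex_norm_square)
  finally show ?thesis by (simp only: of_real_eq_iff)
qed

lemma unitary_column_norm:
  assumes "unitary n M" "l < n"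
  shows "(\<Sum>j<n. (cmod (M $$ (j,l)))\<^sup>2) = 1"
  using unitary_isometry[OF assms(1), of "\<lambda>j. if j = l then 1 else 0"] assms(2)
  by (simp add: if_distrib[of "\<lambda>x. _ * x"] if_distrib[of "\<lambda>x. (cmod x)\<^sup>2"] cong: if_cong)

lemma unitary_row_norm:
  assumes "unitary n M" "l < n"
  shows "(\<Sum>j<n. (cmod (M $$ (l,j)))\<^sup>2) = 1"
  using unitary_column_norm[OF unitary_adjoint[OF assms(1)] assms(2)]
    mat_adjoint_index[OF unitary_carrier[OF assms(1)]] assms(2) by simp

text \<open>
  With \<open>w\<close> the \<open>l\<close>-th eigenvector of the third matrix, \<open>A\<close> and \<open>B\<close> the first two,
  \<open>\<langle>i[A,B]w,w\<rangle> = - 2 Im \<langle>Bw,Aw\<rangle>\<close>, which is at most \<open>\<parallel>Aw\<parallel>\<^sup>2 + \<parallel>Bw\<parallel>\<^sup>2 \<le> 2\<close> in modulus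
  when \<open>A\<close> and \<open>B\<close> are contractions.
\<close>
lemma commutator_form_bound:
  assumes U: "unitary n U" and V: "unitary n V" and W: "unitary n W"
    and a: "\<And>i. i < n \<Longrightarrow> \<bar>a i\<bar> \<le> 1" and b: "\<And>i. i < n \<Longrightarrow> \<bar>b i\<bar> \<le> 1"
  shows "\<bar>commutator_form n U V W a b c\<bar> \<le> 2 * (\<Sum>l<n. \<bar>c l\<bar>)"
proof -
  define \<alpha> where "\<alpha> = mat_adjoint U * V"
  define \<beta> where "\<beta> = mat_adjoint V * W"
  define \<gamma> where "\<gamma> = mat_adjoint W * U"
  have un: "unitary n \<alpha>" "unitary n \<beta>" "unitary n \<gamma>"
    unfolding \<alpha>_def \<beta>_def \<gamma>_def by (intro unitary_mult unitary_adjoint U V W)+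
  have l: "\<bar>\<Sum>i<n. \<Sum>j<n. a i * b j * triple_overlap U V W i j l\<bar> \<le> 2" if "l < n" for l
  proof -
    \<comment> \<open>In the eigenbasis of A, x holds the conjugated coordinates of Aw and y those of Bw.\<close>
    define x where "x i = complex_of_real (a i) * \<gamma> $$ (l,i)" for i
    define y where "y i = (\<Sum>j<n. \<alpha> $$ (i,j) * (complex_of_real (b j) * \<beta> $$ (j,l)))" for i
    have sq: "s\<^sup>2 * t \<le> t" if "\<bar>s\<bar> \<le> 1" "0 \<le> t" for s t :: real
      using that mult_right_mono[of "s\<^sup>2" 1 t] by (simp add: abs_square_le_1)
    have "(\<Sum>i<n. (cmod (x i))\<^sup>2) \<le> (\<Sum>i<n. (cmod (\<gamma> $$ (l,i)))\<^sup>2)"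
      by (intro sum_mono) (auto simp: x_def norm_mult power_mult_distrib intro!: sq a)
    hence xs: "(\<Sum>i<n. (cmod (x i))\<^sup>2) \<le> 1" using unitary_row_norm[OF un(3) that] by simp
    have "(\<Sum>i<n. (cmod (y i))\<^sup>2) = (\<Sum>j<n. (cmod (complex_of_real (b j) * \<beta> $$ (j,l)))\<^sup>2)"
      unfolding y_def by (rule unitary_isometry[OF un(1)])
    also have "\<dots> \<le> (\<Sum>j<n. (cmod (\<beta> $$ (j,l)))\<^sup>2)"
      by (intro sum_mono) (auto simp: norm_mult power_mult_distrib intro!: sq b)
    finally have ys: "(\<Sum>i<n. (cmod (y i))\<^sup>2) \<le> 1" using unitary_column_norm[OF un(2) that] by simp
    have "(\<Sum>i<n. \<Sum>j<n. a i * b j * triple_overlap U V W i j l) = - 2 * Im (\<Sum>i<n. x i * y i)"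
      unfolding x_def y_def sum_distrib_left Im_sum
      by (intro sum.cong refl) (simp add: triple_overlap_def \<alpha>_def \<beta>_def \<gamma>_def algebra_simps)
    hence "\<bar>\<Sum>i<n. \<Sum>j<n. a i * b j * triple_overlap U V W i j l\<bar> \<le> 2 * cmod (\<Sum>i<n. x i * y i)"
      using abs_Im_le_cmod[of "\<Sum>i<n. x i * y i"] by (simp add: abs_mult)
    also have "\<dots> \<le> 2 * (\<Sum>i<n. cmod (x i) * cmod (y i))"
      using norm_sum[of "\<lambda>i. x i * y i" "{..<n}"] by (simp add: norm_mult)
    also have "\<dots> \<le> (\<Sum>i<n. (cmod (x i))\<^sup>2 + (cmod (y i))\<^sup>2)"
      unfolding sum_distrib_left
      by (intro sum_mono) (metis mult.assoc sum_squares_bound)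
    also have "\<dots> \<le> 2" using xs ys by (simp add: sum.distrib)
    finally show ?thesis .
  qed
  have "commutator_form n U V W a b c = (\<Sum>l<n. c l * (\<Sum>i<n. \<Sum>j<n. a i * b j * triple_overlap U V W i j l))"
    using commutator_form_rotate[of n W U V c a b]
    by (simp add: commutator_form_def sum_distrib_left triple_overlap_rotate[of W] mult_ac)
  also have "\<bar>\<dots>\<bar> \<le> (\<Sum>l<n. \<bar>c l\<bar> * 2)"
    by (rule order.trans[OF sum_abs]) (auto simp: abs_mult intro!: sum_mono mult_left_mono l)
  finally show ?thesis by (simp add: sum_distrib_left mult.commute)
qed

text \<open>
  Eigenvalues of the projection onto the first \<open>m\<close> eigenvectors.
\<close>
definition below :: "nat \<Rightarrow> nat \<Rightarrow> real" where
  "below m i = (if i < m then 1 else 0)"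

lemma sum_abs_le_count:
  assumes "\<And>i. i < n \<Longrightarrow> \<bar>f i\<bar> \<le> below m i"
  shows "(\<Sum>i<n. \<bar>f i\<bar>) \<le> m"
proof -
  have "(\<Sum>i<n. \<bar>f i\<bar>) \<le> (\<Sum>i<n. below m i)" by (intro sum_mono) (use assms in auto)
  also have "\<dots> = card ({..<n} \<inter> {..<m})" by (simp add: below_def sum.If_cases lessThan_def)
  also have "\<dots> \<le> m" using card_mono[of "{..<m}" "{..<n} \<inter> {..<m}"] by simp
  finally show ?thesis by simp
qed

text \<open>
  The four bounds come from the same estimate, applied with the trace evaluated in different
  eigenbases: \<open>k\<close> and \<open>q\<close> use that \<open>2E - 1\<close> is a contraction for a projection \<open>E\<close>; \<open>2p\<close> and
  \<open>2(n-p)\<close> use the ranks of \<open>E\<close> and \<open>1 - E\<close>.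
\<close>
lemma commutator_form_extremal_bound:
  assumes U: "unitary n U" and V: "unitary n V" and W: "unitary n W" and p: "p \<le> n"
    and b: "\<And>j. j < n \<Longrightarrow> \<bar>b j\<bar> \<le> below q j" and c: "\<And>l. l < n \<Longrightarrow> \<bar>c l\<bar> \<le> below k l"
  shows "\<bar>commutator_form n U V W (below p) b c\<bar> \<le> Min {k, q, 2 * p, 2 * (n - p)}"
proof -
  let ?T = "commutator_form n U V W (below p) b c"
  have b1: "\<bar>b j\<bar> \<le> 1" and c1: "\<bar>c j\<bar> \<le> 1" if "j < n" for j
    using b[OF that] c[OF that] by (auto simp: below_def split: if_splits)
  have shift: "commutator_form n U V W (\<lambda>i. s * below p i + t * 1) b c = s * ?T" for s t
    by (simp only: commutator_form_add commutator_form_scale commutator_form_const[OF U V W])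
  \<comment> \<open>The eigenvalues of 2E - 1, which are all 1 or -1.\<close>
  define r where "r i = 2 * below p i + (-1) * 1" for i
  have r: "\<bar>r i\<bar> \<le> 1" for i by (simp add: r_def below_def)
  have T: "commutator_form n U V W r b c = 2 * ?T" unfolding r_def by (rule shift)
  have 1: "\<bar>2 * ?T\<bar> \<le> 2 * (\<Sum>l<n. \<bar>c l\<bar>)" unfolding T[symmetric]
    by (rule commutator_form_bound[OF U V W r b1])
  have "commutator_form n W U V c r b = 2 * ?T" using T commutator_form_rotate[of n W U V] by simp
  hence 2: "\<bar>2 * ?T\<bar> \<le> 2 * (\<Sum>l<n. \<bar>b l\<bar>)"
    using commutator_form_bound[OF W U V, of c r b, OF c1 r] by simp
  have "commutator_form n V W U b c (below p) = ?T" using commutator_form_rotate[of n U V W] by simp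
  hence 3: "\<bar>?T\<bar> \<le> 2 * (\<Sum>l<n. \<bar>below p l\<bar>)"
    using commutator_form_bound[OF V W U, of b c "below p", OF b1 c1] by simp
  have "commutator_form n V W U b c (\<lambda>i. - 1 * below p i + 1 * 1) = - ?T"
    using commutator_form_rotate[of n U V W] shift[of "-1" 1] by simp
  hence 4: "\<bar>?T\<bar> \<le> 2 * (\<Sum>l<n. \<bar>- 1 * below p l + 1 * 1\<bar>)"
    using commutator_form_bound[OF V W U, of b c "\<lambda>i. - 1 * below p i + 1 * 1", OF b1 c1] by simp
  have "(\<Sum>l<n. \<bar>- 1 * below p l + 1 * 1\<bar>) = (\<Sum>l<n. if p \<le> l then 1 else 0)"
    by (intro sum.cong) (auto simp: below_def)
  also have "\<dots> = card ({..<n} \<inter> {p..})" by (simp add: sum.If_cases atLeast_def)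
  also have "{..<n} \<inter> {p..} = {p..<n}" by auto
  finally have 5: "(\<Sum>l<n. \<bar>- 1 * below p l + 1 * 1\<bar>) = real (n - p)" by simp
  have "(\<Sum>l<n. \<bar>c l\<bar>) \<le> k" "(\<Sum>l<n. \<bar>b l\<bar>) \<le> q" "(\<Sum>l<n. \<bar>below p l\<bar>) \<le> p"
    using sum_abs_le_count[OF c] sum_abs_le_count[OF b] sum_abs_le_count[of n "below p" p]
    by (auto simp: below_def)
  hence "\<bar>?T\<bar> \<le> k" "\<bar>?T\<bar> \<le> q" "\<bar>?T\<bar> \<le> real (2 * p)" "\<bar>?T\<bar> \<le> real (2 * (n - p))"
    using 1 2 3 4 5 by auto
  thus ?thesis by (auto simp: min_def)
qed

section \<open>Summation over spectral layers\<close>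

text \<open>
  Abel summation: a list is a constant plus a combination of initial segments, with its
  successive differences as coefficients.
\<close>
lemma layer_decomposition:
  assumes "i \<le> m"
  shows "f i = f m + (\<Sum>p<m. (f p - f (Suc p)) * below (Suc p) i)"
proof -
  have "(\<Sum>p<m. (f p - f (Suc p)) * below (Suc p) i) = (\<Sum>p\<in>{..<m} \<inter> {p. i < Suc p}. f p - f (Suc p))"
    by (simp add: below_def if_distrib[of "\<lambda>x. _ * x"] sum.If_cases cong: if_cong)
  also have "{..<m} \<inter> {p. i < Suc p} = {i..<m}" by auto
  also have "(\<Sum>p\<in>{i..<m}. f p - f (Suc p)) = f i - f m"
    using sum_Suc_diff'[OF assms, of f] by (simp add: sum_subtractf)
  finally show ?thesis by simp
qed

text \<open>
  Both sides are decomposed into layers of \<open>a\<close> and of the moduli of \<open>b\<close>; the coefficients are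
  nonnegative because the lists are non-increasing, so it suffices to compare the layers.  In the
  layer with \<open>p + 1\<close> eigenvectors of the first matrix and \<open>q + 1\<close> of the second, the right-hand
  side counts the \<open>j < k\<close> with \<open>j < q + 1\<close> and \<open>j div 2 < min (p + 1) (n - p - 1)\<close>, which is the
  bound of \<open>commutator_form_extremal_bound\<close>.
\<close>
lemma commutator_form_spread_bound:
  assumes U: "unitary n U" and V: "unitary n V" and W: "unitary n W" and k: "k \<le> n"
    and a: "\<And>i j. i \<le> j \<Longrightarrow> j < n \<Longrightarrow> a j \<le> a i"
    and b: "\<And>i j. i \<le> j \<Longrightarrow> j < n \<Longrightarrow> \<bar>b j\<bar> \<le> \<bar>b i\<bar>"
    and c: "\<And>l. l < n \<Longrightarrow> \<bar>c l\<bar> \<le> below k l"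
  shows "\<bar>commutator_form n U V W a b c\<bar> \<le> (\<Sum>j<k. \<bar>b j\<bar> * (a (j div 2) - a (n - 1 - j div 2)))"
proof (cases "n = 0")
  case True
  thus ?thesis using k by (simp add: commutator_form_def)
next
  case False
  define m where "m = n - 1"
  have n: "n = Suc m" using False by (simp add: m_def)
  define \<delta> where "\<delta> p = a p - a (Suc p)" for p
  \<comment> \<open>Continuing the moduli by 0 makes their decomposition free of a constant term: unlike for a,
    adding a constant to them would change the right-hand side.\<close>
  define B where "B q = (if q < n then \<bar>b q\<bar> else 0)" for q
  define \<tau> where "\<tau> q = B q - B (Suc q)" for q
  have \<delta>0: "\<delta> p \<ge> 0" if "p < m" for p using a[of p "Suc p"] that n by (simp add: \<delta>_def)
  have \<tau>0: "\<tau> q \<ge> 0" for q using b[of q "Suc q"] by (simp add: \<tau>_def B_def)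
  have aL: "a i = a m * 1 + (\<Sum>p<m. \<delta> p * below (Suc p) i)" if "i < n" for i
    using layer_decomposition[of i m a] that n by (simp add: \<delta>_def)
  have BL: "\<bar>b j\<bar> = (\<Sum>q<n. \<tau> q * below (Suc q) j)" if "j < n" for j
    using layer_decomposition[of j n B] that by (simp add: \<tau>_def B_def)
  define b' where "b' q j = sgn (b j) * below (Suc q) j" for q j
  have bL: "b j = (\<Sum>q<n. \<tau> q * b' q j)" if "j < n" for j
  proof -
    have "(\<Sum>q<n. \<tau> q * b' q j) = sgn (b j) * \<bar>b j\<bar>"
      unfolding BL[OF that] sum_distrib_left by (simp add: b'_def mult_ac)
    thus ?thesis by (simp add: sgn_mult_abs)
  qed
  have b'1: "\<bar>b' q j\<bar> \<le> below (Suc q) j" for q j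
    by (simp add: b'_def below_def abs_sgn_eq)
  define T where "T p q = commutator_form n U V W (below (Suc p)) (b' q) c" for p q
  have "commutator_form n U V W a b c
      = commutator_form n U V W (\<lambda>i. a m * 1 + (\<Sum>p<m. \<delta> p * below (Suc p) i)) b c"
    by (rule commutator_form_cong) (use aL in auto)
  also have "\<dots> = (\<Sum>p<m. \<delta> p * commutator_form n U V W (below (Suc p)) b c)"
    by (simp only: commutator_form_add commutator_form_scale commutator_form_const[OF U V W]
        commutator_form_sum[OF finite_lessThan])
  also have "\<dots> = (\<Sum>p<m. \<delta> p * (\<Sum>q<n. \<tau> q * T p q))"
  proof (intro sum.cong refl arg_cong2[of _ _ _ _ "(*)"])
    fix p
    have "commutator_form n U V W (below (Suc p)) b c = commutator_form n V W U b c (below (Suc p))"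
      by (rule commutator_form_rotate)
    also have "\<dots> = commutator_form n V W U (\<lambda>j. \<Sum>q<n. \<tau> q * b' q j) c (below (Suc p))"
      by (rule commutator_form_cong) (use bL in auto)
    also have "\<dots> = (\<Sum>q<n. \<tau> q * T p q)"
      by (simp add: commutator_form_sum T_def commutator_form_rotate[of n U V W])
    finally show "commutator_form n U V W (below (Suc p)) b c = (\<Sum>q<n. \<tau> q * T p q)" .
  qed
  also have "\<dots> = (\<Sum>p<m. \<Sum>q<n. \<delta> p * \<tau> q * T p q)"
    by (simp add: sum_distrib_left mult_ac)
  finally have expand: "commutator_form n U V W a b c = (\<Sum>p<m. \<Sum>q<n. \<delta> p * \<tau> q * T p q)" .
  have "\<bar>commutator_form n U V W a b c\<bar> \<le> (\<Sum>p<m. \<Sum>q<n. \<delta> p * \<tau> q *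
      (\<Sum>j<k. below (Suc q) j * (below (Suc p) (j div 2) - below (Suc p) (m - j div 2))))"
    unfolding expand
  proof (rule order.trans[OF sum_abs], rule sum_mono, rule order.trans[OF sum_abs], rule sum_mono)
    fix p q assume "p \<in> {..<m}" "q \<in> {..<n}"
    hence pq: "p < m" "q < n" by auto
    define M where "M = Min {k, Suc q, 2 * Suc p, 2 * (n - Suc p)}"
    have "(\<Sum>j<k. below (Suc q) j * (below (Suc p) (j div 2) - below (Suc p) (m - j div 2)))
        = (\<Sum>j<k. if j < M then 1 else 0)"
    proof (rule sum.cong[OF refl])
      fix j assume "j \<in> {..<k}"
      hence j: "j < k" "j < n" using k by auto
      have 1: "j div 2 < Suc p \<longleftrightarrow> j < 2 * Suc p" by (simp add: div_less_iff_less_mult mult.commute)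
      have "m - x < Suc p \<longleftrightarrow> \<not> x < n - Suc p" if "x \<le> m" for x using pq n that by auto
      from this[of "j div 2"] have 2: "m - j div 2 < Suc p \<longleftrightarrow> \<not> j < 2 * (n - Suc p)"
        using j n by (simp add: div_less_iff_less_mult mult.commute del: diff_Suc_Suc)
      have 3: "j < 2 * Suc p \<or> j < 2 * (n - Suc p)"
        using j(2) pq n by (cases "j < 2 * Suc p") auto
      show "below (Suc q) j * (below (Suc p) (j div 2) - below (Suc p) (m - j div 2))
          = (if j < M then 1 else 0)"
        unfolding below_def 1 2 M_def using j 3 by auto
    qed
    also have "\<dots> = card ({..<k} \<inter> {..<M})" by (simp add: sum.If_cases lessThan_def)
    also have "{..<k} \<inter> {..<M} = {..<M}" by (auto simp: M_def)
    finally have e: "(\<Sum>j<k. below (Suc q) j * (below (Suc p) (j div 2) - below (Suc p) (m - j div 2))) = M"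
      by simp
    have "\<bar>T p q\<bar> \<le> M"
      unfolding T_def M_def by (rule commutator_form_extremal_bound[OF U V W _ b'1 c]) (use pq n in auto)
    thus "\<bar>\<delta> p * \<tau> q * T p q\<bar> \<le> \<delta> p * \<tau> q *
      (\<Sum>j<k. below (Suc q) j * (below (Suc p) (j div 2) - below (Suc p) (m - j div 2)))"
      unfolding e using \<delta>0[OF pq(1)] \<tau>0[of q] by (simp add: abs_mult mult_left_mono)
  qed
  also have "\<dots> = (\<Sum>p<m. \<Sum>j<k. \<Sum>q<n. \<delta> p * \<tau> q *
      (below (Suc q) j * (below (Suc p) (j div 2) - below (Suc p) (m - j div 2))))"
    unfolding sum_distrib_left by (rule sum.cong[OF refl], rule sum.swap)
  also have "\<dots> = (\<Sum>j<k. \<Sum>p<m. \<Sum>q<n. \<delta> p * \<tau> q *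
      (below (Suc q) j * (below (Suc p) (j div 2) - below (Suc p) (m - j div 2))))"
    by (rule sum.swap)
  also have "\<dots> = (\<Sum>j<k. \<bar>b j\<bar> * (a (j div 2) - a (n - 1 - j div 2)))"
  proof (rule sum.cong[OF refl])
    fix j assume "j \<in> {..<k}"
    hence j: "j < n" using k by auto
    have i: "j div 2 < n" "m - j div 2 < n" using j n by auto
    have d: "a (j div 2) - a (m - j div 2)
        = (\<Sum>p<m. \<delta> p * (below (Suc p) (j div 2) - below (Suc p) (m - j div 2)))"
      unfolding aL[OF i(1)] aL[OF i(2)] by (simp add: right_diff_distrib sum_subtractf)
    have "\<bar>b j\<bar> * (a (j div 2) - a (m - j div 2)) = (\<Sum>p<m. \<Sum>q<n. \<delta> p * \<tau> q *
      (below (Suc q) j * (below (Suc p) (j div 2) - below (Suc p) (m - j div 2))))"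
      unfolding BL[OF j] d sum_product by (subst sum.swap) (simp add: mult_ac)
    thus "(\<Sum>p<m. \<Sum>q<n. \<delta> p * \<tau> q *
      (below (Suc q) j * (below (Suc p) (j div 2) - below (Suc p) (m - j div 2))))
      = \<bar>b j\<bar> * (a (j div 2) - a (n - 1 - j div 2))"
      by (simp add: m_def)
  qed
  finally show ?thesis .
qed

section \<open>Unitary orbits and the main inequality\<close>

lemma unitary_conjugate_diagonal:
  assumes U: "unitary n U" and Y: "unitary n Y" and l: "l < n"
  shows "(mat_adjoint Y * unitary_diag n U (\<lambda>i. complex_of_real (a i)) * Y) $$ (l,l)
       = complex_of_real (\<Sum>i<n. a i * (cmod ((mat_adjoint U * Y) $$ (i,l)))\<^sup>2)"
proof -
  note c = unitary_carrier[OF U] unitary_adjoint_carrier[OF U]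
    unitary_carrier[OF Y] unitary_adjoint_carrier[OF Y]
  define M where "M = mat_adjoint U * Y"
  have M: "M \<in> carrier_mat n n" using c by (simp add: M_def)
  have N: "mat_diag n (\<lambda>i. complex_of_real (a i)) * M \<in> carrier_mat n n" using M by simp
  have "mat_adjoint Y * unitary_diag n U (\<lambda>i. complex_of_real (a i)) * Y
      = mat_adjoint M * (mat_diag n (\<lambda>i. complex_of_real (a i)) * M)"
    using c by (simp add: M_def unitary_diag_def mat_assoc[of _ n] mat_adjoint_mult[of _ n n _ n]
        mat_adjoint_adjoint[of _ n n])
  also have "\<dots> $$ (l,l) = (\<Sum>i<n. complex_of_real (a i) * (M $$ (i,l) * cnj (M $$ (i,l))))"
    unfolding mat_mult_index[OF mat_adjoint_carrier[OF M] N l l]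
    using l by (intro sum.cong refl) (simp add: mat_diag_mult_left[OF M] mat_adjoint_index[OF M])
  finally show ?thesis by (simp only: M_def of_real_sum of_real_mult complex_norm_square)
qed

text \<open>
  Differentiation of \<open>|g|\<^sup>2\<close> through \<open>2 Re(g' \<cdot> cnj g)\<close>, where each term of \<open>g'\<close> gains a factor
  \<open>i x j\<close>.
\<close>
lemma has_derivative_norm_trig_sum:
  fixes n :: nat and z :: "nat \<Rightarrow> complex" and x :: "nat \<Rightarrow> real"
  defines "g \<equiv> \<lambda>t. \<Sum>j<n. z j * cis (t * x j)"
  shows "((\<lambda>t. (cmod (g t))\<^sup>2) has_real_derivative
    - 2 * Im (\<Sum>j<n. x j * (z j * cis (t * x j) * cnj (g t)))) (at t)"
proof -
  define P where "P = (\<Sum>j<n. x j * Re (z j * cis (t * x j)))"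
  define Q where "Q = (\<Sum>j<n. x j * Im (z j * cis (t * x j)))"
  have R: "((\<lambda>t. Re (g t)) has_real_derivative - Q) (at t)"
    unfolding g_def Q_def Re_sum sum_negf[symmetric]
    by (rule DERIV_sum) (auto intro!: derivative_eq_intros simp: algebra_simps)
  have I: "((\<lambda>t. Im (g t)) has_real_derivative P) (at t)"
    unfolding g_def P_def Im_sum
    by (rule DERIV_sum) (auto intro!: derivative_eq_intros simp: algebra_simps)
  have "(\<Sum>j<n. x j * (z j * cis (t * x j) * cnj (g t))) = Complex P Q * cnj (g t)"
    unfolding mult.assoc[symmetric] sum_distrib_right[symmetric]
    by (rule arg_cong2[of _ _ _ _ "(*)"])
       (simp_all add: complex_eq_iff P_def Q_def Re_sum Im_sum mult.assoc)
  hence e: "- 2 * Im (\<Sum>j<n. x j * (z j * cis (t * x j) * cnj (g t)))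
      = 2 * Re (g t) * (- Q) + 2 * Im (g t) * P"
    by (simp add: algebra_simps)
  show ?thesis unfolding e cmod_power2
    by (rule derivative_eq_intros R I refl | simp)+
qed

text \<open>
  The left-hand side is \<open>\<phi>(0) - \<phi>(1)\<close> for the function \<open>\<phi>(t) = tr(E(t)\<^sup>* A E(t) S)\<close>, where
  \<open>E(t) = exp(itX)\<close> and \<open>S\<close> has eigenbasis \<open>W\<close> and eigenvalues \<open>c\<close>.  Moving the group onto
  \<open>S\<close>, the derivative is the commutator form of \<open>A\<close>, \<open>X\<close> and \<open>E(t) S E(t)\<^sup>*\<close>, whose eigenbasis is
  \<open>E(t) W\<close>.
\<close>
lemma trace_difference_eq_commutator_form:
  fixes a x c :: "nat \<Rightarrow> real"
  assumes U: "unitary n U" and V: "unitary n V" and W: "unitary n W"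
  defines "A \<equiv> unitary_diag n U (\<lambda>i. complex_of_real (a i))"
    and "E \<equiv> unitary_diag n V (\<lambda>j. cis (x j))"
  obtains Y where "unitary n Y"
    "(\<Sum>l<n. c l * Re ((mat_adjoint W * (A - mat_adjoint E * A * E) * W) $$ (l,l)))
      = - commutator_form n U V Y a x c"
proof -
  define F where "F t = unitary_diag n V (\<lambda>j. cis (t * x j))" for t
  define Y where "Y t = F t * W" for t
  have F: "unitary n (F t)" for t unfolding F_def by (rule unitary_diag_unitary[OF V]) simp
  have Y: "unitary n (Y t)" for t unfolding Y_def by (rule unitary_mult[OF F W])
  note cc = unitary_carrier[OF U] unitary_adjoint_carrier[OF U]
    unitary_carrier[OF V] unitary_adjoint_carrier[OF V]
    unitary_carrier[OF W] unitary_adjoint_carrier[OF W]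
    unitary_carrier[OF F] unitary_adjoint_carrier[OF F]
  have A: "A \<in> carrier_mat n n" unfolding A_def by (rule unitary_diag_carrier[OF U])
  define z where "z i l j = (mat_adjoint U * V) $$ (i,j) * (mat_adjoint V * W) $$ (j,l)" for i l j
  define g where "g i l t = (\<Sum>j<n. z i l j * cis (t * x j))" for i l t
  have VY: "mat_adjoint V * Y t = mat_diag n (\<lambda>j. cis (t * x j)) * (mat_adjoint V * W)" for t
    using cc by (simp add: Y_def F_def unitary_diag_def mat_assoc[of _ n] unitary_cancel[OF V])
  have VYi: "(mat_adjoint V * Y t) $$ (j,l) = cis (t * x j) * (mat_adjoint V * W) $$ (j,l)"
    if "j < n" "l < n" for j l t
  proof -
    have M: "mat_adjoint V * W \<in> carrier_mat n n" using cc by simp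
    show ?thesis unfolding VY mat_diag_mult_left[OF M] using that by simp
  qed
  have UYi: "(mat_adjoint U * Y t) $$ (i,l) = g i l t" if "i < n" "l < n" for i l t
  proof -
    have Yc: "Y t \<in> carrier_mat n n" by (rule unitary_carrier[OF Y])
    have "mat_adjoint U * Y t = (mat_adjoint U * V) * (mat_adjoint V * Y t)"
      using cc Yc by (simp add: mat_assoc[of _ n] unitary_cancel[OF V])
    also have "\<dots> $$ (i,l) = (\<Sum>j<n. (mat_adjoint U * V) $$ (i,j) * (mat_adjoint V * Y t) $$ (j,l))"
      by (rule mat_mult_index[of _ n n _ n]) (use cc Yc that in auto)
    also have "\<dots> = g i l t"
      unfolding g_def z_def by (intro sum.cong refl) (simp add: VYi that mult_ac)
    finally show ?thesis .
  qed
  define \<phi> where "\<phi> t = (\<Sum>l<n. c l * (\<Sum>i<n. a i * (cmod (g i l t))\<^sup>2))" for t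
  have \<phi>: "\<phi> t = (\<Sum>l<n. c l * Re ((mat_adjoint (Y t) * A * Y t) $$ (l,l)))" for t
    unfolding \<phi>_def A_def
    by (intro sum.cong refl) (simp add: unitary_conjugate_diagonal[OF U Y] UYi)
  have d: "(\<phi> has_real_derivative commutator_form n U V (Y t) a x c) (at t)" for t
  proof -
    have "(\<phi> has_real_derivative (\<Sum>l<n. c l * (\<Sum>i<n. a i *
        (- 2 * Im (\<Sum>j<n. x j * (z i l j * cis (t * x j) * cnj (g i l t))))))) (at t)"
      unfolding \<phi>_def g_def
      by (intro DERIV_sum DERIV_cmult has_derivative_norm_trig_sum)
    also have "(\<Sum>l<n. c l * (\<Sum>i<n. a i *
        (- 2 * Im (\<Sum>j<n. x j * (z i l j * cis (t * x j) * cnj (g i l t))))))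
      = (\<Sum>l<n. \<Sum>i<n. \<Sum>j<n. c l * a i * x j * triple_overlap U V (Y t) i j l)"
    proof (rule sum.cong[OF refl])
      fix l assume "l \<in> {..<n}"
      hence l: "l < n" by simp
      have "a i * (- 2 * Im (\<Sum>j<n. x j * (z i l j * cis (t * x j) * cnj (g i l t))))
          = (\<Sum>j<n. a i * x j * triple_overlap U V (Y t) i j l)" if i: "i < n" for i
        unfolding Im_sum sum_distrib_left
      proof (rule sum.cong[OF refl])
        fix j assume "j \<in> {..<n}"
        hence j: "j < n" by simp
        have t: "triple_overlap U V (Y t) i j l = - 2 * Im (z i l j * cis (t * x j) * cnj (g i l t))"
          unfolding triple_overlap_def overlap_cnj[OF U Y i l] UYi[OF i l] VYi[OF j l] z_def
          by (simp only: mult_ac)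
        show "a i * (- 2 * Im (x j * (z i l j * cis (t * x j) * cnj (g i l t))))
            = a i * x j * triple_overlap U V (Y t) i j l"
          unfolding t by (simp add: algebra_simps)
      qed
      thus "c l * (\<Sum>i<n. a i * (- 2 * Im (\<Sum>j<n. x j * (z i l j * cis (t * x j) * cnj (g i l t)))))
          = (\<Sum>i<n. \<Sum>j<n. c l * a i * x j * triple_overlap U V (Y t) i j l)"
        by (simp add: sum_distrib_left mult.assoc)
    qed
    also have "\<dots> = commutator_form n (Y t) U V c a x"
      unfolding commutator_form_def by (simp add: triple_overlap_rotate[of "Y t"] mult_ac)
    also have "\<dots> = commutator_form n U V (Y t) a x c" by (rule commutator_form_rotate)
    finally show ?thesis .
  qed
  have "\<exists>s. 0 < s \<and> s < 1 \<and> \<phi> 1 - \<phi> 0 = (1 - 0) * commutator_form n U V (Y s) a x c"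
    by (rule MVT2) (use d in auto)
  then obtain s where s: "\<phi> 1 - \<phi> 0 = commutator_form n U V (Y s) a x c" by auto
  have F1: "F 1 = E" and F0: "F 0 = 1\<^sub>m n" by (simp_all add: F_def E_def unitary_diag_one[OF V])
  have E: "E \<in> carrier_mat n n" "mat_adjoint E \<in> carrier_mat n n" using cc(7,8)[of 1] by (simp_all add: F1)
  have Y0: "Y 0 = W" using cc by (simp add: Y_def F0)
  have Y1: "mat_adjoint (Y 1) * A * Y 1 = mat_adjoint W * (mat_adjoint E * A * E) * W"
    using cc E A by (simp add: Y_def F1 mat_adjoint_mult[of _ n n _ n] mat_assoc[of _ n])
  have M: "mat_adjoint E * A * E \<in> carrier_mat n n" using E A by simp
  have "mat_adjoint W * (A - mat_adjoint E * A * E) * W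
      = mat_adjoint W * A * W - mat_adjoint W * (mat_adjoint E * A * E) * W"
    using cc A M
    by (simp add: mult_minus_distrib_mat[of _ n n _ n] minus_mult_distrib_mat[of _ n n _ _ n])
  also have "\<dots> = mat_adjoint (Y 0) * A * Y 0 - mat_adjoint (Y 1) * A * Y 1"
    by (simp only: Y0 Y1)
  finally have D: "mat_adjoint W * (A - mat_adjoint E * A * E) * W
      = mat_adjoint (Y 0) * A * Y 0 - mat_adjoint (Y 1) * A * Y 1" .
  have Yd: "dim_row (Y t) = n" "dim_col (Y t) = n" for t
    using unitary_carrier[OF Y[of t]] by auto
  have "(\<Sum>l<n. c l * Re ((mat_adjoint W * (A - mat_adjoint E * A * E) * W) $$ (l,l))) = \<phi> 0 - \<phi> 1"
    unfolding D \<phi> sum_subtractf[symmetric]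
    by (intro sum.cong refl) (subst index_minus_mat, auto simp: right_diff_distrib Yd)
  thus ?thesis using that[OF Y[of s]] s by simp
qed

lemma sum_list_take_map: "k \<le> n \<Longrightarrow> sum_list (take k (map f [0..<n])) = (\<Sum>j<k. f j)"
  by (simp add: take_map take_upt sum_list_sum_nth lessThan_atLeast0)

lemma hermitian_unitary_difference:
  assumes A: "A \<in> carrier_mat n n" "mat_adjoint A = A" and E: "E \<in> carrier_mat n n"
  shows "hermitian_mat (A - mat_adjoint E * A * E)"
proof -
  have E': "mat_adjoint E \<in> carrier_mat n n" using E by (rule mat_adjoint_carrier)
  define B where "B = mat_adjoint E * A * E"
  have B: "B \<in> carrier_mat n n" using A E E' by (simp add: B_def)
  have AB: "A - B \<in> carrier_mat n n" using B by (rule minus_carrier_mat)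
  have B': "mat_adjoint B = B"
    using A E E' by (simp add: B_def mat_adjoint_mult[of _ n n _ n] mat_adjoint_adjoint[of _ n n]
        mat_assoc[of _ n])
  have "mat_adjoint (A - B) = A - B"
  proof (rule eq_matI)
    fix i j assume "i < dim_row (A - B)" "j < dim_col (A - B)"
    hence ij: "i < n" "j < n" using AB by auto
    have "cnj (A $$ (j,i)) = A $$ (i,j)" "cnj (B $$ (j,i)) = B $$ (i,j)"
      using mat_adjoint_index[OF A(1) ij] mat_adjoint_index[OF B ij] A(2) B' by simp_all
    thus "mat_adjoint (A - B) $$ (i,j) = (A - B) $$ (i,j)"
      unfolding mat_adjoint_index[OF AB ij] using ij B A(1) by simp
  qed (use AB B in auto)
  thus ?thesis by (simp add: hermitian_mat_def B_def)
qed

text \<open>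
  The matrix is Hermitian, so its singular values are the moduli of its eigenvalues; \<open>c\<close> is the
  list of signs of the \<open>k\<close> eigenvalues of largest modulus.
\<close>
lemma singular_value_sum_le_commutator_form:
  fixes a x :: "nat \<Rightarrow> real"
  assumes U: "unitary n U" and V: "unitary n V" and k: "k \<le> n"
  defines "A \<equiv> unitary_diag n U (\<lambda>i. complex_of_real (a i))"
    and "E \<equiv> unitary_diag n V (\<lambda>j. cis (x j))"
  obtains Y c where "unitary n Y" "\<And>l. l < n \<Longrightarrow> \<bar>c l\<bar> \<le> below k l"
    "sum_list (take k (rev (sort (singular_values (A - mat_adjoint E * A * E)))))
      \<le> \<bar>commutator_form n U V Y a x c\<bar>"
proof -
  define C where "C = A - mat_adjoint E * A * E"
  have A: "A \<in> carrier_mat n n" unfolding A_def by (rule unitary_diag_carrier[OF U])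
  have A': "mat_adjoint A = A" by (simp add: A_def unitary_diag_adjoint[OF U])
  have E: "E \<in> carrier_mat n n" unfolding E_def by (rule unitary_diag_carrier[OF V])
  have "C \<in> carrier_mat n n" unfolding C_def
    using A E mat_adjoint_carrier[OF E] by (intro minus_carrier_mat) simp
  moreover have "hermitian_mat C" unfolding C_def by (rule hermitian_unitary_difference[OF A A' E])
  ultimately obtain W \<gamma> where W: "unitary n W" and C: "C = unitary_diag n W (\<lambda>i. complex_of_real (\<gamma> i))"
    and \<gamma>: "\<And>i j. i \<le> j \<Longrightarrow> j < n \<Longrightarrow> \<bar>\<gamma> j\<bar> \<le> \<bar>\<gamma> i\<bar>"
    using hermitian_spectral[of C n abs] by metis
  define c where "c l = sgn (\<gamma> l) * below k l" for l
  have c: "\<bar>c l\<bar> \<le> below k l" for l by (simp add: c_def below_def abs_sgn_eq)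
  obtain Y where Y: "unitary n Y"
    "(\<Sum>l<n. c l * Re ((mat_adjoint W * C * W) $$ (l,l))) = - commutator_form n U V Y a x c"
    by (rule trace_difference_eq_commutator_form[OF U V W, where a = a and x = x and c = c,
          folded A_def E_def, folded C_def])
  have sv: "singular_values C = map (\<lambda>i. \<bar>\<gamma> i\<bar>) [0..<n]"
    unfolding C singular_values_unitary_diag[OF W] using \<gamma> by (intro rev_sort_antitone)
  have "sum_list (take k (rev (sort (singular_values C)))) = (\<Sum>l<k. \<bar>\<gamma> l\<bar>)"
    unfolding sv using \<gamma> k by (subst rev_sort_antitone) (auto simp: sum_list_take_map)
  also have "\<dots> = (\<Sum>l<n. if l < k then \<bar>\<gamma> l\<bar> else 0)"
    using k by (intro sum.mono_neutral_cong_left) auto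
  also have "\<dots> = (\<Sum>l<n. c l * Re ((mat_adjoint W * C * W) $$ (l,l)))"
    unfolding C unitary_diag_diagonalize[OF W]
    by (intro sum.cong refl) (simp add: mat_diag_def c_def below_def abs_sgn mult.commute)
  finally have "sum_list (take k (rev (sort (singular_values C)))) \<le> \<bar>commutator_form n U V Y a x c\<bar>"
    unfolding Y(2) by simp
  thus ?thesis using that[OF Y(1) c] by (simp add: C_def)
qed

lemma length_singular_values_unitary_diag:
  "unitary n V \<Longrightarrow> length (singular_values (unitary_diag n V (\<lambda>i. complex_of_real (d i)))) = n"
  by (simp add: singular_values_unitary_diag)

text \<open>
  The entrywise product of two non-increasing nonnegative lists is non-increasing, so its
  \<open>k\<close> largest entries are its first \<open>k\<close> ones.
\<close>
lemma submajorized_spread_product: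
  assumes U: "unitary n U" and V: "unitary n V"
    and a: "\<And>i j. i \<le> j \<Longrightarrow> j < n \<Longrightarrow> a j \<le> a i"
    and b: "\<And>i j. i \<le> j \<Longrightarrow> j < n \<Longrightarrow> \<bar>b j\<bar> \<le> \<bar>b i\<bar>"
  defines "A \<equiv> unitary_diag n U (\<lambda>i. complex_of_real (a i))"
    and "B \<equiv> unitary_diag n V (\<lambda>i. complex_of_real (b i))"
  assumes len: "length s = n"
    and s: "\<And>k. k \<le> n \<Longrightarrow> sum_list (take k (rev (sort s)))
      \<le> (\<Sum>j<k. \<bar>b j\<bar> * (a (j div 2) - a (n - 1 - j div 2)))"
  shows "s \<prec>\<^sub>w entrywise_prod (singular_values B) (spectral_spread (direct_sum_mat A A))"
proof -
  define w where "w j = \<bar>b j\<bar> * (a (j div 2) - a (n - 1 - j div 2))" for j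
  have sv: "singular_values B = map (\<lambda>i. \<bar>b i\<bar>) [0..<n]"
    unfolding B_def singular_values_unitary_diag[OF V] using b by (intro rev_sort_antitone)
  have "spectral_spread (direct_sum_mat A A) = map (\<lambda>i. a (i div 2) - a (n - 1 - i div 2)) [0..<n]"
    unfolding A_def using a by (intro spectral_spread_direct_sum[OF U])
  hence e: "entrywise_prod (singular_values B) (spectral_spread (direct_sum_mat A A)) = map w [0..<n]"
    unfolding sv entrywise_prod_def w_def by (simp add: map2_map_map)
  have w: "w j \<le> w i" if "i \<le> j" "j < n" for i j
  proof -
    have "a (j div 2) \<le> a (i div 2)" "a (n - 1 - i div 2) \<le> a (n - 1 - j div 2)"
      "a (n - 1 - j div 2) \<le> a (j div 2)"
      by (rule a; use that div_le_mono[OF that(1), of 2] in simp)+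
    thus ?thesis unfolding w_def using b[OF that] by (intro mult_mono) auto
  qed
  show ?thesis unfolding e submajorized_def
    using len s by (auto simp: rev_sort_antitone[OF w] sum_list_take_map w_def)
qed

theorem theorem3p5:
  fixes n :: nat and A X U :: "complex mat"
  assumes "A \<in> carrier_mat n n" and "hermitian_mat A"
    and "X \<in> carrier_mat n n" and "hermitian_mat X"
    and "U = mat_exp (\<i> \<cdot>\<^sub>m X)"
  shows "singular_values (A - mat_adjoint U * A * U)
           \<prec>\<^sub>w entrywise_prod (singular_values X) (spectral_spread (direct_sum_mat A A))
       \<and> singular_values (A - mat_adjoint U * A * U)
           \<prec>\<^sub>w entrywise_prod (singular_values A) (spectral_spread (direct_sum_mat X X))"
proof
  let ?s = "singular_values (A - mat_adjoint U * A * U)"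
  have Ue: "U = unitary_diag n V (\<lambda>j. cis (x j))"
    if "unitary n V" "X = unitary_diag n V (\<lambda>j. complex_of_real (x j))" for V x
    unfolding assms(5) that(2) unitary_diag_smult[OF that(1)] mat_exp_unitary_diag[OF that(1)] cis_conv_exp ..
  have len: "length ?s = n"
  proof -
    obtain V x where V: "unitary n V" "X = unitary_diag n V (\<lambda>j. complex_of_real (x j))"
      using hermitian_spectral[OF assms(3,4), of "\<lambda>x. x"] by metis
    have U: "U \<in> carrier_mat n n" unfolding Ue[OF V] by (rule unitary_diag_carrier[OF V(1)])
    have "A - mat_adjoint U * A * U \<in> carrier_mat n n"
      using assms(1) U mat_adjoint_carrier[OF U] by (intro minus_carrier_mat) simp
    moreover have "hermitian_mat (A - mat_adjoint U * A * U)"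
      using assms(1,2) U by (intro hermitian_unitary_difference) (auto simp: hermitian_mat_def)
    ultimately obtain W d where "unitary n W"
      "A - mat_adjoint U * A * U = unitary_diag n W (\<lambda>j. complex_of_real (d j))"
      using hermitian_spectral[of "A - mat_adjoint U * A * U" n "\<lambda>x. x"] by metis
    thus ?thesis by (simp add: length_singular_values_unitary_diag)
  qed
  show "?s \<prec>\<^sub>w entrywise_prod (singular_values X) (spectral_spread (direct_sum_mat A A))"
  proof -
    obtain P a where P: "unitary n P" and A: "A = unitary_diag n P (\<lambda>i. complex_of_real (a i))"
      and a: "\<And>i j. i \<le> j \<Longrightarrow> j < n \<Longrightarrow> a j \<le> a i"
      using hermitian_spectral[OF assms(1,2), of "\<lambda>x. x"] by metis
    obtain Q x where Q: "unitary n Q" and X: "X = unitary_diag n Q (\<lambda>i. complex_of_real (x i))"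
      and x: "\<And>i j. i \<le> j \<Longrightarrow> j < n \<Longrightarrow> \<bar>x j\<bar> \<le> \<bar>x i\<bar>"
      using hermitian_spectral[OF assms(3,4), of abs] by metis
    have "sum_list (take k (rev (sort ?s))) \<le> (\<Sum>j<k. \<bar>x j\<bar> * (a (j div 2) - a (n - 1 - j div 2)))"
      if k: "k \<le> n" for k
    proof -
      obtain Y c where Y: "unitary n Y" "\<And>l. l < n \<Longrightarrow> \<bar>c l\<bar> \<le> below k l"
        "sum_list (take k (rev (sort ?s))) \<le> \<bar>commutator_form n P Q Y a x c\<bar>"
        unfolding Ue[OF Q X] A using singular_value_sum_le_commutator_form[OF P Q k, of a x] by blast
      note Y(3)
      also have "\<bar>commutator_form n P Q Y a x c\<bar> \<le> (\<Sum>j<k. \<bar>x j\<bar> * (a (j div 2) - a (n - 1 - j div 2)))"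
        by (rule commutator_form_spread_bound[OF P Q Y(1) k a x Y(2)])
      finally show ?thesis .
    qed
    thus ?thesis using submajorized_spread_product[OF P Q, of a x, OF a x len] by (simp add: A X)
  qed
  show "?s \<prec>\<^sub>w entrywise_prod (singular_values A) (spectral_spread (direct_sum_mat X X))"
  proof -
    obtain P a where P: "unitary n P" and A: "A = unitary_diag n P (\<lambda>i. complex_of_real (a i))"
      and a: "\<And>i j. i \<le> j \<Longrightarrow> j < n \<Longrightarrow> \<bar>a j\<bar> \<le> \<bar>a i\<bar>"
      using hermitian_spectral[OF assms(1,2), of abs] by metis
    obtain Q x where Q: "unitary n Q" and X: "X = unitary_diag n Q (\<lambda>i. complex_of_real (x i))"
      and x: "\<And>i j. i \<le> j \<Longrightarrow> j < n \<Longrightarrow> x j \<le> x i"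
      using hermitian_spectral[OF assms(3,4), of "\<lambda>x. x"] by metis
    have "sum_list (take k (rev (sort ?s))) \<le> (\<Sum>j<k. \<bar>a j\<bar> * (x (j div 2) - x (n - 1 - j div 2)))"
      if k: "k \<le> n" for k
    proof -
      obtain Y c where Y: "unitary n Y" "\<And>l. l < n \<Longrightarrow> \<bar>c l\<bar> \<le> below k l"
        "sum_list (take k (rev (sort ?s))) \<le> \<bar>commutator_form n P Q Y a x c\<bar>"
        unfolding Ue[OF Q X] A using singular_value_sum_le_commutator_form[OF P Q k, of a x] by blast
      note Y(3)
      also have "\<bar>commutator_form n P Q Y a x c\<bar> = \<bar>commutator_form n Q P Y x a c\<bar>"
        by (simp add: commutator_form_flip[OF P Q Y(1)])
      also have "\<dots> \<le> (\<Sum>j<k. \<bar>a j\<bar> * (x (j div 2) - x (n - 1 - j div 2)))"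
        by (rule commutator_form_spread_bound[OF Q P Y(1) k x a Y(2)])
      finally show ?thesis .
    qed
    thus ?thesis using submajorized_spread_product[OF Q P, of x a, OF x a len] by (simp add: A X)
  qed
qed

end
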